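(* Let $D,\widehat{D}$ be symmetric slice domains in $\mathbb{H}$ and let $\phi:\mathcal{Q}(\mathcal{O}_s(D))\to\mathcal{Q}(\mathcal{O}_s(\widehat{D}))$ be any (unital) $\mathbb{R}$-algebra homomorphism. Then there exists exactly one regular map $h:\widehat{D}\to D$ such that $\phi(f)=f\circ h$ for all $f\in\mathcal{Q}(\mathcal{O}_s(D))$.
   Context: $\mathbb{H}$ denotes the real quaternions, $\mathbb{S}=\{I\in\mathbb{H}: I^2=-1\}$, and for $I\in\mathbb{S}$, $\mathbb{C}_I=\mathbb{R}+I\mathbb{R}$. A domain is a nonempty connected open subset of $\mathbb{H}\cong\mathbb{R}^4$ (resp. of $\mathbb{C}_I$). A symmetric slice domain is a domain $D\subset\mathbb{H}$ such that $D\cap\mathbb{R}\neq\emptyset$, $D\cap\mathbb{C}_I$ is a domain in $\mathbb{C}_I$ for every $I\in\mathbb{S}$, and whenever $x+Iy\in D$ ($x,y\in\mathbb{R}$, $I\in\mathbb{S}$) then $x+Jy\in D$ for all $J\in\mathbb{S}$. A function $f:D\to\mathbb{H}$ is regular if for every $I\in\mathbb{S}$ its restriction $f_I$ to $D\cap\mathbb{C}_I$ has continuous partial derivatives and satisfies $\frac12\left(\frac{\partial}{\partial x}+I\frac{\partial}{\partial y}\right)f_I(x+Iy)=0$ for all $x+Iy\in D\cap\mathbb{C}_I$. A regular $f$ is slice preserving if $f(D\cap\mathbb{C}_I)\subset\mathbb{C}_I$ for every $I\in\mathbb{S}$. $\mathcal{O}_s(D)$ is the set of slice preserving regular functions on $D$;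 with pointwise operations it is a commutative integral domain and an $\mathbb{R}$-algebra. $\mathcal{Q}(\mathcal{O}_s(D))$ is its quotient field, whose elements are the functions $\alpha/\beta$ with $\alpha,\beta\in\mathcal{O}_s(D)$, $\beta\not\equiv0$. The equality $\phi(f)=f\circ h$ for $f=\alpha/\beta$ means that $\beta\circ h\not\equiv 0$ and $\phi(f)=(\alpha\circ h)/(\beta\circ h)$. *)

theory Defs
  imports "HOL-Analysis.Analysis" "HOL-Algebra.Module"
begin

section \<open>Quaternions\<close>

datatype quat = Quat (qre: real) (qi: real) (qj: real) (qk: real)

lemma quat_eq_iff: "p = q \<longleftrightarrow> qre p = qre q \<and> qi p = qi q \<and> qj p = qj q \<and> qk p = qk q"
  by (cases p; cases q) simp

instantiation quat :: ring_1
begin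

definition "0 = Quat 0 0 0 0"
definition "1 = Quat 1 0 0 0"
definition "p + q = Quat (qre p + qre q) (qi p + qi q) (qj p + qj q) (qk p + qk q)"
definition "p - q = Quat (qre p - qre q) (qi p - qi q) (qj p - qj q) (qk p - qk q)" for p q :: quat
definition "- q = Quat (- qre q) (- qi q) (- qj q) (- qk q)" for q :: quat
definition "p * q = Quat
  (qre p * qre q - qi p * qi q - qj p * qj q - qk p * qk q)
  (qre p * qi q + qi p * qre q + qj p * qk q - qk p * qj q)
  (qre p * qj q - qi p * qk q + qj p * qre q + qk p * qi q)
  (qre p * qk q + qi p * qj q - qj p * qi q + qk p * qre q)" for p q :: quat

instance
  by standard
    (simp_all add: zero_quat_def one_quat_def plus_quat_def minus_quat_def uminus_quat_def
      times_quat_def quat_eq_iff algebra_simps)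

end

lemma quat_sel_zero [simp]: "qre 0 = 0" "qi 0 = 0" "qj 0 = 0" "qk 0 = 0"
  by (simp_all add: zero_quat_def)

lemma quat_sel_one [simp]: "qre 1 = 1" "qi 1 = 0" "qj 1 = 0" "qk 1 = 0"
  by (simp_all add: one_quat_def)

lemma quat_sel_plus [simp]:
  "qre (p + q) = qre p + qre q" "qi (p + q) = qi p + qi q"
  "qj (p + q) = qj p + qj q" "qk (p + q) = qk p + qk q"
  by (simp_all add: plus_quat_def)

lemma quat_sel_minus [simp]:
  "qre (p - q) = qre p - qre q" "qi (p - q) = qi p - qi q"
  "qj (p - q) = qj p - qj q" "qk (p - q) = qk p - qk q"
  by (simp_all add: minus_quat_def)

lemma quat_sel_uminus [simp]:
  "qre (- q) = - qre q" "qi (- q) = - qi q" "qj (- q) = - qj q" "qk (- q) = - qk q"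
  by (simp_all add: uminus_quat_def)

lemma quat_sel_times [simp]:
  "qre (p * q) = qre p * qre q - qi p * qi q - qj p * qj q - qk p * qk q"
  "qi (p * q) = qre p * qi q + qi p * qre q + qj p * qk q - qk p * qj q"
  "qj (p * q) = qre p * qj q - qi p * qk q + qj p * qre q + qk p * qi q"
  "qk (p * q) = qre p * qk q + qi p * qj q - qj p * qi q + qk p * qre q"
  by (simp_all add: times_quat_def)

lemma quat_sumsq_pos:
  fixes q :: quat
  assumes "q \<noteq> 0"
  shows "(qre q)\<^sup>2 + (qi q)\<^sup>2 + (qj q)\<^sup>2 + (qk q)\<^sup>2 > 0"
proof -
  have "qre q \<noteq> 0 \<or> qi q \<noteq> 0 \<or> qj q \<noteq> 0 \<or> qk q \<noteq> 0"
    using assms by (simp add: quat_eq_iff)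
  then show ?thesis
    by (smt (verit) zero_le_power2 zero_less_power2)
qed

instantiation quat :: real_algebra_1
begin

definition "r *\<^sub>R q = Quat (r * qre q) (r * qi q) (r * qj q) (r * qk q)" for q :: quat

instance
  by standard (simp_all add: scaleR_quat_def quat_eq_iff algebra_simps)

end

lemma quat_sel_scaleR [simp]:
  "qre (r *\<^sub>R q) = r * qre q" "qi (r *\<^sub>R q) = r * qi q"
  "qj (r *\<^sub>R q) = r * qj q" "qk (r *\<^sub>R q) = r * qk q"
  by (simp_all add: scaleR_quat_def)

lemma quat_sel_of_real [simp]:
  "qre (of_real r) = r" "qi (of_real r) = 0" "qj (of_real r) = 0" "qk (of_real r) = 0"
  by (simp_all add: of_real_def)

instantiation quat :: real_div_algebra
begin

definition "inverse q = (1 / ((qre q)\<^sup>2 + (qi q)\<^sup>2 + (qj q)\<^sup>2 + (qk q)\<^sup>2))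
  *\<^sub>R Quat (qre q) (- qi q) (- qj q) (- qk q)"
definition "p div q = p * inverse q" for p q :: quat

instance
proof
  fix q :: quat
  assume "q \<noteq> 0"
  then show "inverse q * q = 1" "q * inverse q = 1"
    using quat_sumsq_pos[of q]
    by (simp_all add: inverse_quat_def quat_eq_iff power2_eq_square flip: add_divide_distrib)
next
  show "inverse (0::quat) = 0"
    by (simp add: inverse_quat_def quat_eq_iff)
qed (simp add: divide_quat_def)

end

instantiation quat :: euclidean_space
begin

definition "p \<bullet> q = qre p * qre q + qi p * qi q + qj p * qj q + qk p * qk q" for p q :: quat
definition "norm q = sqrt (q \<bullet> q)" for q :: quat
definition "sgn q = q /\<^sub>R norm q" for q :: quat
definition "dist p q = norm (p - q)" for p q :: quat
definition
  "(uniformity :: (quat \<times> quat) filter) = (INF e\<in>{0<..}. principal {(x, y). dist x y < e})"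
definition
  "open (U :: quat set) \<longleftrightarrow> (\<forall>x\<in>U. eventually (\<lambda>(x', y). x' = x \<longrightarrow> y \<in> U) uniformity)"
definition "Basis = {Quat 1 0 0 0, Quat 0 1 0 0, Quat 0 0 1 0, Quat 0 0 0 1}"

instance
proof
  fix p q r :: quat and a :: real
  show "p \<bullet> q = q \<bullet> p" "(p + q) \<bullet> r = p \<bullet> r + q \<bullet> r" "(a *\<^sub>R p) \<bullet> q = a * (p \<bullet> q)"
    by (simp_all add: inner_quat_def algebra_simps)
  show "0 \<le> p \<bullet> p"
    by (simp add: inner_quat_def)
  show "p \<bullet> p = 0 \<longleftrightarrow> p = 0"
    using quat_sumsq_pos[of p] by (cases "p = 0") (simp_all add: inner_quat_def power2_eq_square)
  show "norm p = sqrt (p \<bullet> p)" "sgn p = p /\<^sub>R norm p" "dist p q = norm (p - q)"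
    by (simp_all add: norm_quat_def sgn_quat_def dist_quat_def)
  show "(Basis :: quat set) \<noteq> {}" "finite (Basis :: quat set)"
    by (simp_all add: Basis_quat_def)
  show "p \<in> Basis \<Longrightarrow> q \<in> Basis \<Longrightarrow> p \<bullet> q = (if p = q then 1 else 0)"
    unfolding Basis_quat_def insert_iff empty_iff inner_quat_def
    by (elim disjE FalseE) simp_all
  show "(\<forall>u\<in>Basis. p \<bullet> u = 0) \<longleftrightarrow> p = 0"
    by (auto simp add: Basis_quat_def inner_quat_def quat_eq_iff[of p 0])
next
  show "(uniformity :: (quat \<times> quat) filter) = (INF e\<in>{0<..}. principal {(x, y). dist x y < e})"
    by (rule uniformity_quat_def)
  show "open U \<longleftrightarrow> (\<forall>x\<in>U. \<forall>\<^sub>F (x', y) in uniformity. x' = x \<longrightarrow> y \<in> U)" for U :: "quat set"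
    by (rule open_quat_def)
qed

end

lemma euler_four_squares:
  fixes a b c d e f g h :: real
  shows "(a * e - b * f - c * g - d * h)\<^sup>2 + (a * f + b * e + c * h - d * g)\<^sup>2 +
    (a * g - b * h + c * e + d * f)\<^sup>2 + (a * h + b * g - c * f + d * e)\<^sup>2 =
    (a\<^sup>2 + b\<^sup>2 + c\<^sup>2 + d\<^sup>2) * (e\<^sup>2 + f\<^sup>2 + g\<^sup>2 + h\<^sup>2)"
  by Groebner_Basis.algebra

instance quat :: real_normed_div_algebra
proof
  fix p q :: quat
  have "(p * q) \<bullet> (p * q) = (p \<bullet> p) * (q \<bullet> q)"
    unfolding inner_quat_def quat_sel_times power2_eq_square [symmetric]
    by (rule euler_four_squares)
  then show "norm (p * q) = norm p * norm q"
    by (simp add: norm_quat_def real_sqrt_mult)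
qed


section \<open>Symmetric slice domains and regular functions\<close>

definition imag_units :: "quat set" where
  "imag_units = {I. I\<^sup>2 = - 1}"

definition slice_pt :: "quat \<Rightarrow> real \<Rightarrow> real \<Rightarrow> quat" where
  "slice_pt I x y = of_real x + I * of_real y"

definition slice_plane :: "quat \<Rightarrow> quat set" where
  "slice_plane I = {slice_pt I x y | x y. True}"

definition domain_in :: "quat set \<Rightarrow> quat set \<Rightarrow> bool" where
  "domain_in X U \<longleftrightarrow> U \<noteq> {} \<and> connected U \<and> openin (top_of_set X) U"

definition symmetric_slice_domain :: "quat set \<Rightarrow> bool" where
  "symmetric_slice_domain D \<longleftrightarrow>
     domain_in UNIV D \<and>
     D \<inter> \<real> \<noteq> {} \<and>
     (\<forall>I\<in>imag_units. domain_in (slice_plane I) (D \<inter> slice_plane I)) \<and>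
     (\<forall>I\<in>imag_units. \<forall>J\<in>imag_units. \<forall>x y. slice_pt I x y \<in> D \<longrightarrow> slice_pt J x y \<in> D)"

text \<open>Here \<open>fx\<close> and \<open>fy\<close> are the two partial derivatives of \<open>(x, y) \<mapsto> f (x + I y)\<close>.
  Only values of \<open>f\<close> on \<open>D\<close> matter when \<open>D\<close> is open.\<close>

definition regular_on :: "quat set \<Rightarrow> (quat \<Rightarrow> quat) \<Rightarrow> bool" where
  "regular_on D f \<longleftrightarrow>
     (\<forall>I\<in>imag_units. \<exists>fx fy :: real \<times> real \<Rightarrow> quat.
        continuous_on {(x, y). slice_pt I x y \<in> D} fx \<and>
        continuous_on {(x, y). slice_pt I x y \<in> D} fy \<and>
        (\<forall>x y. slice_pt I x y \<in> D \<longrightarrow>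
           ((\<lambda>t. f (slice_pt I t y)) has_vector_derivative fx (x, y)) (at x) \<and>
           ((\<lambda>t. f (slice_pt I x t)) has_vector_derivative fy (x, y)) (at y) \<and>
           (1/2) *\<^sub>R (fx (x, y) + I * fy (x, y)) = 0))"

definition slice_preserving_on :: "quat set \<Rightarrow> (quat \<Rightarrow> quat) \<Rightarrow> bool" where
  "slice_preserving_on D f \<longleftrightarrow>
     (\<forall>I\<in>imag_units. f ` (D \<inter> slice_plane I) \<subseteq> slice_plane I)"

text \<open>The real algebra of slice preserving regular functions on \<open>D\<close>. Functions on \<open>D\<close> are
  represented extensionally, so that equality in the algebra is equality on \<open>D\<close>.\<close>

definition slice_alg :: "quat set \<Rightarrow> (real, quat \<Rightarrow> quat) module" where
  "slice_alg D = \<lparr>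
     carrier = {f \<in> extensional D. regular_on D f \<and> slice_preserving_on D f},
     mult = (\<lambda>f g. \<lambda>q\<in>D. f q * g q),
     one = (\<lambda>q\<in>D. 1),
     zero = (\<lambda>q\<in>D. 0),
     add = (\<lambda>f g. \<lambda>q\<in>D. f q + g q),
     smult = (\<lambda>r f. \<lambda>q\<in>D. r *\<^sub>R f q)\<rparr>"


section \<open>The quotient field of a domain\<close>

text \<open>The fraction \<open>a/b\<close> is the set of all pairs \<open>(c, d)\<close> with \<open>c/d = a/b\<close>. The operations are
  given on representatives; the unions range over sets that are all equal if \<open>R\<close> is an
  integral domain (and an algebra over the scalars).\<close>

definition frac_of :: "('a, 'm) ring_scheme \<Rightarrow> 'a \<Rightarrow> 'a \<Rightarrow> ('a \<times> 'a) set" where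
  "frac_of R a b = {(c, d). c \<in> carrier R \<and> d \<in> carrier R - {\<zero>\<^bsub>R\<^esub>} \<and> c \<otimes>\<^bsub>R\<^esub> b = a \<otimes>\<^bsub>R\<^esub> d}"

definition quot_field :: "('r, 'a, 'm) module_scheme \<Rightarrow> ('r, ('a \<times> 'a) set) module" where
  "quot_field R = \<lparr>
     carrier = {frac_of R a b | a b. a \<in> carrier R \<and> b \<in> carrier R - {\<zero>\<^bsub>R\<^esub>}},
     mult = (\<lambda>F G. \<Union>(a, b)\<in>F. \<Union>(c, d)\<in>G. frac_of R (a \<otimes>\<^bsub>R\<^esub> c) (b \<otimes>\<^bsub>R\<^esub> d)),
     one = frac_of R \<one>\<^bsub>R\<^esub> \<one>\<^bsub>R\<^esub>,
     zero = frac_of R \<zero>\<^bsub>R\<^esub> \<one>\<^bsub>R\<^esub>,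
     add = (\<lambda>F G. \<Union>(a, b)\<in>F. \<Union>(c, d)\<in>G.
              frac_of R (a \<otimes>\<^bsub>R\<^esub> d \<oplus>\<^bsub>R\<^esub> c \<otimes>\<^bsub>R\<^esub> b) (b \<otimes>\<^bsub>R\<^esub> d)),
     smult = (\<lambda>r F. \<Union>(a, b)\<in>F. frac_of R (r \<odot>\<^bsub>R\<^esub> a) b)\<rparr>"

definition alg_hom ::
  "('r, 'a, 'm) module_scheme \<Rightarrow> ('r, 'b, 'n) module_scheme \<Rightarrow> ('a \<Rightarrow> 'b) set" where
  "alg_hom A B =
     {\<phi> \<in> ring_hom A B. \<forall>r. \<forall>x\<in>carrier A. \<phi> (r \<odot>\<^bsub>A\<^esub> x) = r \<odot>\<^bsub>B\<^esub> \<phi> x}"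

text \<open>\<open>comp_eq E h F G\<close> says \<open>G = F \<circ> h\<close> for fractions \<open>F = \<alpha>/\<beta>\<close> and \<open>G = \<gamma>/\<delta>\<close> of functions,
  where \<open>h\<close> is defined on \<open>E\<close>: \<open>\<beta> \<circ> h\<close> is not identically zero, and \<open>\<gamma>/\<delta> = (\<alpha> \<circ> h)/(\<beta> \<circ> h)\<close>
  as functions, that is, wherever both denominators are nonzero. It is not required here
  that \<open>\<alpha> \<circ> h\<close> and \<open>\<beta> \<circ> h\<close> be slice preserving and regular, since \<open>h\<close> is arbitrary.\<close>

definition comp_eq ::
  "quat set \<Rightarrow> (quat \<Rightarrow> quat) \<Rightarrow> ((quat \<Rightarrow> quat) \<times> (quat \<Rightarrow> quat)) set \<Rightarrow>
   ((quat \<Rightarrow> quat) \<times> (quat \<Rightarrow> quat)) set \<Rightarrow> bool" where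
  "comp_eq E h F G \<longleftrightarrow>
     (\<forall>(\<alpha>, \<beta>)\<in>F. (\<exists>q\<in>E. \<beta> (h q) \<noteq> 0) \<and>
        (\<forall>(\<gamma>, \<delta>)\<in>G. \<forall>q\<in>E. \<delta> q \<noteq> 0 \<longrightarrow> \<beta> (h q) \<noteq> 0 \<longrightarrow> \<gamma> q / \<delta> q = \<alpha> (h q) / \<beta> (h q)))"

end

theory Submission
  imports Defs "HOL-Complex_Analysis.Complex_Analysis"
begin

text \<open>A slice preserving regular function on a symmetric slice domain \<open>D\<close> is the same thing as a
  holomorphic function \<open>F\<close> on the plane domain \<open>W\<close> traced by \<open>D\<close> on any slice, subject to
  \<open>F (cnj z) = cnj (F z)\<close>: the value at \<open>x + I y\<close> is \<open>Re (F (x + i y)) + I Im (F (x + i y))\<close>, with the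
  same \<open>F\<close> for every imaginary unit \<open>I\<close>, because all slices share the real points of \<open>D\<close> and the
  identity theorem applies (\<open>slice_alg_emb\<close>, \<open>slice_alg_carrier_eq\<close>). The theorem thus becomes a
  statement about \<open>\<real>\<close>-algebra homomorphisms between fields of fractions of such functions.

  The heart of the matter is that a homomorphism \<open>\<phi>\<close> sends holomorphic functions to holomorphic
  functions, although nothing like continuity is assumed (\<open>no_pole_of_germ_hom\<close>). Fix a point \<open>p\<close> of
  the target domain and suppose that the image of \<open>F\<close> has a pole of order \<open>m\<close> at \<open>p\<close>. Take \<open>q = m + 2\<close>
  and an entire function with real coefficients such that \<open>G z = (1 - z) * G (z / a) ^ q\<close>, where
  \<open>a = 2 q\<close> (\<open>entire_power_functional_equation\<close>). The functions \<open>G (F / a ^ k)\<close> are holomorphic on \<open>W\<close>;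
  the orders \<open>N k\<close> of their images at \<open>p\<close> satisfy \<open>N k = q * N (k + 1) - m\<close>, since every
  \<open>1 - F / a ^ k\<close> is mapped to a function with a pole of order \<open>m\<close>. Hence \<open>(q - 1) * N 0 - m\<close> is
  divisible by all powers of \<open>q\<close>, so \<open>m = (m + 1) * N 0\<close>, which no integer \<open>N 0\<close> satisfies.
  This is the mechanism of Iss'sa's theorem on discrete valuations of fields of meromorphic functions.

  Once \<open>\<phi>\<close> restricts to a homomorphism \<open>\<psi>\<close> of the rings of holomorphic functions, evaluation at \<open>p\<close>
  after \<open>\<psi>\<close> is a character, and division by \<open>z - a\<close> with \<open>a = \<psi> (\<lambda>z. z) p\<close> shows that \<open>a\<close> lies in \<open>W\<close>
  and that the character is evaluation at \<open>a\<close> (\<open>hom_of_division\<close>). So the image of the identity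
  function is the stem of the required map, fractions follow by multiplicativity, and uniqueness
  holds because the equation \<open>\<phi> f = f \<circ> h\<close> for the identity function \<open>f\<close> already determines \<open>h\<close>.\<close>

section \<open>Real holomorphic functions\<close>

text \<open>For a set symmetric about the real axis these are the holomorphic functions that equal their
  conjugates \<open>cnj \<circ> F \<circ> cnj\<close>; where they have a Taylor expansion at a real point, its coefficients are
  real.\<close>
definition real_hol :: "complex set \<Rightarrow> (complex \<Rightarrow> complex) set" where
  "real_hol W = {F. F holomorphic_on W \<and> (\<forall>z\<in>W. F (cnj z) = cnj (F z))}"

lemma real_hol_const [intro]: "(\<lambda>z. of_real r) \<in> real_hol W"
  by (simp add: real_hol_def)

lemma real_hol_id [intro]: "(\<lambda>z. z) \<in> real_hol W"
  by (simp add: real_hol_def)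

lemma real_hol_add [intro]: "F \<in> real_hol W \<Longrightarrow> G \<in> real_hol W \<Longrightarrow> (\<lambda>z. F z + G z) \<in> real_hol W"
  by (auto simp: real_hol_def intro!: holomorphic_intros)

lemma real_hol_mult [intro]: "F \<in> real_hol W \<Longrightarrow> G \<in> real_hol W \<Longrightarrow> (\<lambda>z. F z * G z) \<in> real_hol W"
  by (auto simp: real_hol_def intro!: holomorphic_intros)

lemma real_hol_power [intro]: "F \<in> real_hol W \<Longrightarrow> (\<lambda>z. F z ^ n) \<in> real_hol W"
  by (auto simp: real_hol_def intro!: holomorphic_intros)

lemma real_hol_compose:
  assumes "F \<in> real_hol W" "G \<in> real_hol V" "F ` W \<subseteq> V"
  shows "(\<lambda>z. G (F z)) \<in> real_hol W"
proof -
  have "(G \<circ> F) holomorphic_on W"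
    using assms by (intro holomorphic_on_compose_gen) (auto simp: real_hol_def)
  then show ?thesis
    using assms by (simp add: real_hol_def o_def image_subset_iff)
qed

lemma real_hol_zero: "(\<lambda>z. 0) \<in> real_hol W" and real_hol_one: "(\<lambda>z. 1) \<in> real_hol W"
  by (simp_all add: real_hol_def)

lemma real_hol_real:
  assumes "F \<in> real_hol W" "z \<in> W" "Im z = 0"
  shows "Im (F z) = 0"
proof -
  have "cnj z = z" using assms(3) by (simp add: complex_eq_iff)
  then have "F z = cnj (F z)" using assms(1,2) by (metis (mono_tags, lifting) mem_Collect_eq real_hol_def)
  then show ?thesis by (simp add: complex_eq_iff)
qed

text \<open>Near a point where \<open>d\<close> does not vanish \<open>F\<close> must, and the identity theorem spreads this. The
  lemma serves as integrality of the ring and as the cancellation rule for denominators.\<close>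
lemma holomorphic_zero_divisor:
  assumes F: "F holomorphic_on W" and d: "d holomorphic_on W"
    and W: "open W" "connected W" and "w \<in> W" "d w \<noteq> 0"
    and zero: "\<And>z. z \<in> W \<Longrightarrow> F z * d z = 0" and "z \<in> W"
  shows "F z = 0"
proof -
  have "open (W \<inter> d -` (- {0}))"
    using d W holomorphic_on_imp_continuous_on continuous_open_preimage open_Compl by blast
  then have "w islimpt (W \<inter> d -` (- {0}))"
    using assms(5,6) by (intro interior_limit_point) (simp add: interior_open del: interior_Int)
  then show ?thesis
    using zero \<open>z \<in> W\<close> \<open>w \<in> W\<close>
    by (intro analytic_continuation[OF F W, of "W \<inter> d -` (- {0})" w z]) auto
qed

lemma eventually_nonzero_at:
  assumes d: "d holomorphic_on W" and W: "open W" "connected W" and "w \<in> W" "d w \<noteq> 0" "p \<in> W"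
  shows "\<forall>\<^sub>F z in at p. d z \<noteq> 0"
  using non_zero_neighbour_alt[OF d W \<open>p \<in> W\<close> \<open>w \<in> W\<close> \<open>d w \<noteq> 0\<close>]
  by (rule eventually_mono) simp

text \<open>The removable singularities of \<open>c / d\<close> are filled in. The symmetry passes to the filled-in function
  \<open>g\<close> because \<open>g\<close> and its conjugate both solve \<open>g * d = c\<close>, so that \<open>d\<close> can be cancelled.\<close>
lemma real_hol_quotient:
  assumes c: "c \<in> real_hol W" and d: "d \<in> real_hol W"
    and W: "open W" "connected W" and cnj: "\<And>z. z \<in> W \<Longrightarrow> cnj z \<in> W"
    and w: "w \<in> W" "d w \<noteq> 0"
    and no_pole: "\<And>p. p \<in> W \<Longrightarrow> \<not> is_pole (\<lambda>z. c z / d z) p"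
  obtains g where "g \<in> real_hol W" "\<And>z. z \<in> W \<Longrightarrow> g z * d z = c z"
proof -
  define g where "g = remove_sings (\<lambda>z. c z / d z)"
  have hol: "c holomorphic_on W" "d holomorphic_on W"
    using c d by (auto simp: real_hol_def)
  have an: "c analytic_on {p}" "d analytic_on {p}" if "p \<in> W" for p
    using hol that W(1) holomorphic_on_imp_analytic_at by blast+
  have mero: "(\<lambda>z. c z / d z) meromorphic_on {p}" if "p \<in> W" for p
    using an[OF that] by (intro meromorphic_intros analytic_on_imp_meromorphic_on) auto
  have gan: "g analytic_on {p}" if "p \<in> W" for p
    using mero[OF that] no_pole[OF that] remove_sings_analytic_at
    unfolding g_def meromorphic_at_iff not_essential_def by blast
  then have g: "g holomorphic_on W"
    by (meson analytic_imp_holomorphic analytic_on_analytic_at)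
  have eq: "g p * d p = c p" if p: "p \<in> W" for p
  proof -
    have "\<forall>\<^sub>F z in at p. g z = c z / d z"
      unfolding g_def using mero[OF p] by (intro eventually_remove_sings_eq_at) (simp add: meromorphic_at_iff)
    with eventually_nonzero_at[OF hol(2) W w p]
    have ev: "\<forall>\<^sub>F z in at p. g z * d z = c z" by eventually_elim simp
    have "(\<lambda>z. g z * d z) \<midarrow>p\<rightarrow> g p * d p" "c \<midarrow>p\<rightarrow> c p"
      using analytic_at_imp_isCont[OF gan[OF p]] an[OF p, THEN analytic_at_imp_isCont]
      by (auto intro!: tendsto_intros simp: isCont_def)
    then show ?thesis
      using tendsto_cong[OF ev] tendsto_unique[of "at p"] by auto
  qed
  have "g p - (cnj \<circ> g \<circ> cnj) p = 0" if p: "p \<in> W" for p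
  proof (rule holomorphic_zero_divisor[OF _ hol(2) W w _ p])
    have "cnj ` W = W"
      using cnj by (metis complex_cnj_cnj image_eqI image_subsetI subsetI subset_antisym)
    then have "(cnj \<circ> g \<circ> cnj) holomorphic_on W"
      using g W(1) by (intro holomorphic_on_compose_cnj_cnj) simp_all
    then show "(\<lambda>z. g z - (cnj \<circ> g \<circ> cnj) z) holomorphic_on W"
      by (intro holomorphic_on_diff[OF g])
    fix z assume z: "z \<in> W"
    have "cnj (g (cnj z)) * d z = cnj (g (cnj z) * d (cnj z))"
      using d z by (simp add: real_hol_def)
    also have "\<dots> = c z"
      using c eq[OF cnj[OF z]] z by (simp add: real_hol_def)
    finally show "(g z - (cnj \<circ> g \<circ> cnj) z) * d z = 0"
      using eq[OF z] by (simp add: algebra_simps)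
  qed
  then have "cnj (g (cnj z)) = g z" if "z \<in> W" for z
    using that by simp
  then have "g (cnj z) = cnj (g z)" if "z \<in> W" for z
    using that by (metis complex_cnj_cnj)
  then show ?thesis
    using that[of g] g eq by (auto simp: real_hol_def)
qed

text \<open>All holomorphic functions on a symmetric domain form the complexification of \<open>real_hol\<close>. This
  allows complex points to be treated in the same way as real ones, although only real constants
  are available in \<open>real_hol\<close>.\<close>
lemma real_hol_split:
  assumes g: "g holomorphic_on W" and W: "open W" and cnj: "\<And>z. z \<in> W \<Longrightarrow> cnj z \<in> W"
  obtains g1 g2 where "g1 \<in> real_hol W" "g2 \<in> real_hol W"
    "\<And>z. g z = g1 z + \<i> * g2 z" "\<And>z. cnj (g (cnj z)) = g1 z - \<i> * g2 z"
proof -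
  define g1 where "g1 = (\<lambda>z. (g z + cnj (g (cnj z))) / 2)"
  define g2 where "g2 = (\<lambda>z. (g z - cnj (g (cnj z))) / (2 * \<i>))"
  have "cnj ` W = W"
    using cnj by (metis complex_cnj_cnj image_eqI image_subsetI subsetI subset_antisym)
  then have "(cnj \<circ> g \<circ> cnj) holomorphic_on W"
    using g W by (intro holomorphic_on_compose_cnj_cnj) simp_all
  then have "(\<lambda>z. cnj (g (cnj z))) holomorphic_on W" by (simp add: o_def)
  with g have "g1 \<in> real_hol W" "g2 \<in> real_hol W"
    by (auto simp: real_hol_def g1_def g2_def field_simps intro!: holomorphic_intros)
  moreover have "g z = g1 z + \<i> * g2 z" "cnj (g (cnj z)) = g1 z - \<i> * g2 z" for z
    by (simp_all add: g1_def g2_def field_simps)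
  ultimately show ?thesis using that by blast
qed

section \<open>An entire function with a power functional equation\<close>

lemma norm_one_plus_power_minus_one_le:
  fixes w :: complex
  shows "norm ((1 + w) ^ N - 1) \<le> real N * norm w * exp (real N * norm w)"
proof -
  have "norm ((\<Prod>i<N. 1 + w) - 1) \<le> (\<Prod>i<N. 1 + norm w) - 1"
    by (rule norm_prod_minus1_le_prod_minus1)
  then have "norm ((1 + w) ^ N - 1) \<le> (1 + norm w) ^ N - 1"
    by simp
  also have "(1 + norm w) ^ N \<le> exp (norm w) ^ N"
    by (intro power_mono exp_ge_add_one_self) auto
  also have "exp (norm w) ^ N = exp (real N * norm w)"
    by (simp add: exp_of_nat_mult)
  also have "exp t - 1 \<le> t * exp t" for t :: real
    using mult_right_mono[OF exp_ge_add_one_self[of "-t"], of "exp t"]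
    by (simp add: algebra_simps exp_minus field_simps)
  finally show ?thesis by simp
qed

text \<open>The function is the product of the factors \<open>(1 - z / a ^ n) ^ (q ^ n)\<close> with \<open>a = 2 q\<close>: splitting
  off the factor for \<open>n = 0\<close> leaves the \<open>q\<close>-th power of the same product at \<open>z / a\<close>. The zeros move
  away so fast that the multiplicities \<open>q ^ n\<close> do no harm: on the disc of radius \<open>R\<close> the \<open>n\<close>-th factor
  differs from 1 by at most a constant times \<open>q ^ n * R / a ^ n = R / 2 ^ n\<close>.\<close>
lemma entire_power_functional_equation:
  fixes q :: nat
  assumes "q > 0"
  obtains G where "G \<in> real_hol UNIV" "G 0 = 1" "\<And>z. G z = (1 - z) * G (z / of_nat (2 * q)) ^ q"
proof -
  define a where "a = (of_nat (2 * q) :: complex)"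
  define t where "t n z = (1 - z / a ^ n) ^ q ^ n" for n z
  define P where "P N z = (\<Prod>n<N. t n z)" for N z
  define G where "G z = lim (\<lambda>N. P N z)" for z
  have na: "norm a = 2 * real q" "a \<noteq> 0"
    using assms by (simp_all add: a_def norm_mult)
  have bound: "norm (t n z - 1) \<le> R * exp R * (1/2) ^ n" if "norm z \<le> R" for n z R
  proof -
    have eq: "real (q ^ n) * norm (- (z / a ^ n)) = norm z * (1/2) ^ n"
      using assms by (simp add: norm_divide norm_power na power_mult_distrib field_simps)
    have R: "0 \<le> R" using that norm_ge_zero order_trans by blast
    have le: "norm z * (1/2) ^ n \<le> R"
      using mult_mono[OF that power_le_one[of "1/2::real" n] R] by simp
    have "norm (t n z - 1) \<le> norm z * (1/2) ^ n * exp (norm z * (1/2) ^ n)"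
      using norm_one_plus_power_minus_one_le[of "- (z / a ^ n)" "q ^ n"] unfolding eq by (simp add: t_def)
    also have "\<dots> \<le> (R * (1/2) ^ n) * exp R"
      using le that R by (intro mult_mono) auto
    finally show ?thesis by (simp add: algebra_simps)
  qed
  have unif: "uniformly_convergent_on (cball 0 R) P" for R
  proof -
    have "uniformly_convergent_on (cball 0 R) (\<lambda>N z. \<Sum>n<N. norm (t n z - 1))"
    proof (rule Weierstrass_m_test')
      show "norm (norm (t n z - 1)) \<le> R * exp R * (1/2) ^ n" if "z \<in> cball 0 R" for n z
        using bound[of z R n] that by simp
      show "summable (\<lambda>n. R * exp R * (1/2) ^ n)"
        by (intro summable_mult summable_geometric) auto
    qed
    then have "uniformly_convergent_on (cball 0 R) (\<lambda>N z. \<Prod>n<N. t n z)"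
      by (intro uniformly_convergent_on_prod') (auto intro!: continuous_intros simp: t_def na)
    then show ?thesis by (simp add: P_def[abs_def])
  qed
  have ulim: "uniform_limit (cball 0 R) P G sequentially" for R
    using unif[of R] unfolding G_def[abs_def] uniformly_convergent_uniform_limit_iff .
  have lim: "(\<lambda>N. P N z) \<longlonglongrightarrow> G z" for z
    using tendsto_uniform_limitI[OF ulim[of "norm z"], of z] by simp
  have hol: "G holomorphic_on UNIV"
  proof (rule holomorphic_uniform_sequence)
    show "P N holomorphic_on UNIV" for N
      by (auto intro!: holomorphic_intros simp: P_def[abs_def] t_def na)
    fix x :: complex
    have "cball x 1 \<subseteq> cball 0 (norm x + 1)"
      by (simp add: cball_subset_cball_iff)
    then show "\<exists>d>0. cball x d \<subseteq> UNIV \<and> uniform_limit (cball x d) P G sequentially"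
      using uniform_limit_on_subset[OF ulim] zero_less_one by blast
  qed auto
  have "(\<lambda>N. P N (cnj z)) = (\<lambda>N. cnj (P N z))" for z
    by (simp add: P_def t_def a_def)
  then have cnj: "G (cnj z) = cnj (G z)" for z
    using lim[of "cnj z"] tendsto_cnj[OF lim[of z]] LIMSEQ_unique by auto
  have shift: "P (Suc N) z = (1 - z) * P N (z / a) ^ q" for N z
    unfolding P_def prod.lessThan_Suc_shift
    by (simp add: t_def prod_power_distrib mult.commute flip: power_mult)
  have "(\<lambda>N. P (Suc N) z) \<longlonglongrightarrow> (1 - z) * G (z / a) ^ q" for z
    unfolding shift by (intro tendsto_intros lim)
  then have eq: "G z = (1 - z) * G (z / a) ^ q" for z
    using LIMSEQ_Suc[OF lim[of z]] LIMSEQ_unique by blast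
  show ?thesis
  proof (rule that)
    show "G \<in> real_hol UNIV" using hol cnj by (simp add: real_hol_def)
    show "G 0 = 1" using lim[of 0] by (simp add: P_def t_def LIMSEQ_const_iff)
  qed (rule eq[unfolded a_def])
qed

section \<open>Homomorphisms into germs of meromorphic functions\<close>

text \<open>The fixed point of the recursion is \<open>m / (m + 1)\<close>, which is not an integer, while the recursion
  divides the distance to it by \<open>m + 2\<close> in each step.\<close>
lemma no_integer_descent:
  fixes N :: "nat \<Rightarrow> int" and m :: int
  assumes "m > 0" and rec: "\<And>k. N k = (m + 2) * N (Suc k) - m"
  shows False
proof -
  define M where "M k = (m + 1) * N k - m" for k
  have M: "M k = (m + 2) * M (Suc k)" for k
    unfolding M_def by (subst rec[of k]) (simp add: algebra_simps)
  have pow: "M 0 = (m + 2) ^ k * M k" for k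
  proof (induction k)
    case (Suc k)
    show ?case by (subst Suc, subst M) (simp add: algebra_simps)
  qed simp
  have "M 0 = 0"
  proof (rule ccontr)
    assume "M 0 \<noteq> 0"
    \<comment> \<open>any exponent with \<open>\<bar>M 0\<bar> < (m + 2) ^ k\<close> would do\<close>
    define k where "k = nat \<bar>M 0\<bar>"
    have "M k \<noteq> 0" using pow[of k] \<open>M 0 \<noteq> 0\<close> by auto
    have "\<bar>M 0\<bar> < 2 ^ k"
      unfolding k_def by (metis of_nat_less_two_power int_nat_eq abs_ge_zero)
    also have "\<dots> \<le> (m + 2) ^ k"
      using assms(1) by (intro power_mono) auto
    also have "\<dots> \<le> (m + 2) ^ k * \<bar>M k\<bar>"
      using \<open>M k \<noteq> 0\<close> assms(1) by (simp add: mult_le_cancel_left1)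
    also have "\<dots> = \<bar>M 0\<bar>"
      using pow[of k] assms(1) by (simp add: abs_mult)
    finally show False by simp
  qed
  then have "m = (m + 1) * N 0" by (simp add: M_def)
  then have "m + 1 dvd m" by (metis dvd_triv_left)
  then show False using assms(1) zdvd_not_zless[of m "m+1"] by simp
qed

text \<open>Here \<open>U\<close> stands for a homomorphism into the field of germs of meromorphic functions at \<open>p\<close>; a
  germ is represented by a function, and its equations hold near \<open>p\<close> only. With the pole order \<open>m\<close> of
  \<open>U F\<close>, the functions \<open>H k\<close> below are \<open>G\<close> of \<open>F / (2 q) ^ k\<close>, and their images have orders that
  contradict \<open>no_integer_descent\<close>.\<close>
lemma no_pole_of_germ_hom:
  fixes U :: "(complex \<Rightarrow> complex) \<Rightarrow> complex \<Rightarrow> complex" and p :: complex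
  assumes mero: "\<And>F. F \<in> real_hol W \<Longrightarrow> U F meromorphic_on {p}"
    and add: "\<And>F G. F \<in> real_hol W \<Longrightarrow> G \<in> real_hol W \<Longrightarrow>
      \<forall>\<^sub>F z in at p. U (\<lambda>z. F z + G z) z = U F z + U G z"
    and mult: "\<And>F G. F \<in> real_hol W \<Longrightarrow> G \<in> real_hol W \<Longrightarrow>
      \<forall>\<^sub>F z in at p. U (\<lambda>z. F z * G z) z = U F z * U G z"
    and const: "\<And>r. \<forall>\<^sub>F z in at p. U (\<lambda>z. of_real r) z = of_real r"
    and inj: "\<And>F w. F \<in> real_hol W \<Longrightarrow> \<forall>\<^sub>F z in at p. U F z = 0 \<Longrightarrow> w \<in> W \<Longrightarrow> F w = 0"
    and "W \<noteq> {}" and F: "F \<in> real_hol W"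
  shows "\<not> is_pole (U F) p"
proof
  assume pole: "is_pole (U F) p"
  define m where "m = - zorder (U F) p"
  have "m > 0"
    using isolated_pole_imp_neg_zorder[OF _ pole] mero[OF F]
    by (simp add: m_def meromorphic_at_iff)
  define q where "q = nat (m + 2)"
  have q: "q > 0" "q > 1" "int q = m + 2" using \<open>m > 0\<close> by (simp_all add: q_def)
  obtain G where G: "G \<in> real_hol UNIV" "G 0 = 1" "\<And>z. G z = (1 - z) * G (z / of_nat (2 * q)) ^ q"
    by (rule entire_power_functional_equation[OF q(1)], rule that)
  define c where "c k = 1 / real (2 * q) ^ k" for k
  define H where "H k = (\<lambda>z. G (of_real (c k) * F z))" for k
  define L where "L k = (\<lambda>z. of_real 1 + of_real (- c k) * F z)" for k
  have HR: "H k \<in> real_hol W" for k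
    unfolding H_def by (rule real_hol_compose[OF _ G(1)]) (use F in auto)
  have LR: "L k \<in> real_hol W" for k
    unfolding L_def using F by (intro real_hol_add real_hol_mult real_hol_const)
  have HL: "H k = (\<lambda>z. L k z * H (Suc k) z ^ q)" for k
  proof
    fix z
    show "H k z = L k z * H (Suc k) z ^ q"
      unfolding H_def by (subst G(3)) (simp add: L_def c_def mult_ac)
  qed
  have c: "c k \<noteq> 0" for k using q by (simp add: c_def)
  have pow: "\<forall>\<^sub>F z in at p. U (\<lambda>z. E z ^ n) z = U E z ^ n" if E: "E \<in> real_hol W" for E n
  proof (induction n)
    case 0
    then show ?case using const[of 1] by simp
  next
    case (Suc n)
    show ?case using Suc mult[OF E real_hol_power[OF E, of n]]
      by eventually_elim simp
  qed
  have evH: "\<forall>\<^sub>F z in at p. U (H k) z = U (L k) z * U (H (Suc k)) z ^ q" for k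
    using mult[OF LR[of k] real_hol_power[OF HR[of "Suc k"], of q]] pow[OF HR[of "Suc k"], of q]
    unfolding HL[symmetric] by eventually_elim simp
  have evL: "\<forall>\<^sub>F z in at p. U (L k) z = 1 + (- of_real (c k)) * U F z" for k
    using add[OF real_hol_const[of 1] real_hol_mult[OF real_hol_const[of "- c k"] F]]
      mult[OF real_hol_const[of "- c k"] F] const[of 1] const[of "- c k"]
    unfolding L_def[symmetric] by eventually_elim simp
  have nzF: "\<forall>\<^sub>F z in at p. U F z \<noteq> 0"
    using non_zero_neighbour_pole[OF pole] .
  have frF: "\<exists>\<^sub>F z in at p. U F z \<noteq> 0"
    using nzF by (simp add: eventually_frequently)
  have poleL: "is_pole (U (L k)) p" for k
  proof -
    have "is_pole (\<lambda>z. (- of_real (c k)) * U F z + 1) p"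
      using pole c[of k] by (subst is_pole_plus_const_iff[symmetric]) (simp del: mult_minus_left)
    moreover have "\<forall>\<^sub>F z in at p. (- of_real (c k)) * U F z + 1 = U (L k) z"
      using evL[of k] by eventually_elim simp
    ultimately show ?thesis by (rule is_pole_transform) simp
  qed
  have ordL: "zorder (U (L k)) p = - m" for k
  proof -
    have ord: "zorder (\<lambda>z. - of_real (c k) * U F z) p = - m"
      unfolding m_def using c[of k] by (subst zorder_cmult) auto
    have "zorder (U (L k)) p = zorder (\<lambda>z. 1 + (- of_real (c k)) * U F z) p"
      by (rule zorder_cong[OF evL refl])
    also have "\<dots> = zorder (\<lambda>z. (- of_real (c k)) * U F z) p"
    proof (rule zorder_add2)
      show "(\<lambda>z. - of_real (c k) * U F z) meromorphic_on {p}"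
        by (intro meromorphic_intros mero F)
      show "\<exists>\<^sub>F z in at p. - of_real (c k) * U F z \<noteq> 0"
        using frF c[of k] by simp
    qed (use ord \<open>m > 0\<close> in auto)
    finally show ?thesis using ord by simp
  qed
  have nzL: "\<forall>\<^sub>F z in at p. U (L k) z \<noteq> 0" for k
    using non_zero_neighbour_pole[OF poleL] .
  \<comment> \<open>If one image vanished, then, the factors \<open>U (L k)\<close> being nonzero, so would all later ones; by
    injectivity \<open>G (F w / (2 q) ^ j)\<close> would be 0 for all large \<open>j\<close>, but it tends to \<open>G 0 = 1\<close>.\<close>
  have frH: "\<exists>\<^sub>F z in at p. U (H k) z \<noteq> 0" for k
  proof (rule ccontr)
    assume "\<not> ?thesis"
    then have zero: "\<forall>\<^sub>F z in at p. U (H k) z = 0" by (simp add: frequently_def)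
    have zeros: "\<forall>\<^sub>F z in at p. U (H (k + j)) z = 0" for j
    proof (induction j)
      case (Suc j)
      show ?case using Suc nzL[of "k + j"] evH[of "k + j"]
        by eventually_elim (use q in auto)
    qed (use zero in simp)
    obtain w where w: "w \<in> W" using \<open>W \<noteq> {}\<close> by auto
    have "G (of_real (c (k + j)) * F w) = 0" for j
      using inj[OF HR zeros w, of j] by (simp add: H_def)
    moreover have "(\<lambda>j. G (of_real (c (k + j)) * F w)) \<longlonglongrightarrow> G 0"
    proof (rule isCont_tendsto_compose[of 0 G])
      show "isCont G 0"
        using G(1) holomorphic_on_imp_continuous_on[of G UNIV]
        by (simp add: real_hol_def continuous_on_eq_continuous_at)
      have "(\<lambda>j. (1 / (2 * real q)) ^ (j + k)) \<longlonglongrightarrow> 0"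
        by (intro LIMSEQ_ignore_initial_segment LIMSEQ_power_zero) (use q in auto)
      then have "(\<lambda>j. c (k + j)) \<longlonglongrightarrow> 0"
        by (simp add: c_def power_one_over add.commute)
      then show "(\<lambda>j. of_real (c (k + j)) * F w) \<longlonglongrightarrow> 0"
        by (auto intro!: tendsto_eq_intros)
    qed
    ultimately show False using G(2) by (simp add: LIMSEQ_const_iff)
  qed
  have "zorder (U (H k)) p = (m + 2) * zorder (U (H (Suc k))) p - m" for k
  proof -
    let ?V = "U (H (Suc k))"
    have "zorder (U (H k)) p = zorder (\<lambda>z. U (L k) z * ?V z ^ q) p"
      by (rule zorder_cong[OF evH refl])
    also have "\<dots> = zorder (U (L k)) p + zorder (\<lambda>z. ?V z ^ q) p"
      using frH[of "Suc k"] nzL[of k] q(1)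
      by (intro zorder_mult meromorphic_intros mero LR HR) (auto simp: eventually_frequently)
    also have "zorder (\<lambda>z. ?V z ^ q) p = int q * zorder ?V p"
      by (rule zorder_power[OF mero[OF HR] frH])
    finally show ?thesis using ordL q by simp
  qed
  then show False
    by (rule no_integer_descent[OF \<open>m > 0\<close>, of "\<lambda>k. zorder (U (H k)) p"])
qed

section \<open>Homomorphisms between rings of real holomorphic functions\<close>

text \<open>Homomorphisms of \<open>\<real>\<close>-algebras from \<open>real_hol W\<close> to functions on \<open>V\<close>. Functions are total here, so
  that \<open>cong\<close> is what makes \<open>\<psi>\<close> depend only on the values on \<open>W\<close>.\<close>
locale real_hol_hom =
  fixes W V :: "complex set" and \<psi> :: "(complex \<Rightarrow> complex) \<Rightarrow> complex \<Rightarrow> complex"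
  assumes W: "open W" "\<And>z. z \<in> W \<Longrightarrow> cnj z \<in> W"
    and cong: "\<And>F G p. F \<in> real_hol W \<Longrightarrow> G \<in> real_hol W \<Longrightarrow> (\<And>z. z \<in> W \<Longrightarrow> F z = G z) \<Longrightarrow>
      p \<in> V \<Longrightarrow> \<psi> F p = \<psi> G p"
    and add: "\<And>F G p. F \<in> real_hol W \<Longrightarrow> G \<in> real_hol W \<Longrightarrow> p \<in> V \<Longrightarrow>
      \<psi> (\<lambda>z. F z + G z) p = \<psi> F p + \<psi> G p"
    and mult: "\<And>F G p. F \<in> real_hol W \<Longrightarrow> G \<in> real_hol W \<Longrightarrow> p \<in> V \<Longrightarrow>
      \<psi> (\<lambda>z. F z * G z) p = \<psi> F p * \<psi> G p"
    and const: "\<And>r p. p \<in> V \<Longrightarrow> \<psi> (\<lambda>z. of_real r) p = of_real r"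
begin

text \<open>Formally this is evaluation of \<open>(z - a) * g = F - w\<close> at the character \<open>\<lambda>F. \<psi> F p\<close>, which kills
  \<open>z - a\<close>. Since \<open>g\<close>, \<open>a\<close> and \<open>w\<close> need not be real, the equation is first separated into its two
  components over \<open>real_hol W\<close>, and the components are recombined after applying \<open>\<psi>\<close>.\<close>
lemma hom_of_division:
  assumes F: "F \<in> real_hol W" and g: "g holomorphic_on W" and p: "p \<in> V"
    and a: "\<psi> (\<lambda>z. z) p = a" and div: "\<And>z. z \<in> W \<Longrightarrow> (z - a) * g z = F z - w"
  shows "\<psi> F p = w"
proof -
  obtain g1 g2 where g12: "g1 \<in> real_hol W" "g2 \<in> real_hol W"
    and split: "\<And>z. g z = g1 z + \<i> * g2 z" "\<And>z. cnj (g (cnj z)) = g1 z - \<i> * g2 z"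
    by (rule real_hol_split[OF g W]) blast+
  obtain s t u v where st: "a = of_real s + \<i> * of_real t" and uv: "w = of_real u + \<i> * of_real v"
    by (meson complex_eq)
  have eqs: "F z = of_real u + ((z + of_real (- s)) * g1 z + of_real t * g2 z)"
    "of_real (- v) = (z + of_real (- s)) * g2 z + of_real (- t) * g1 z" if z: "z \<in> W" for z
  proof -
    have 1: "(z - of_real s - \<i> * of_real t) * (g1 z + \<i> * g2 z) = F z - of_real u - \<i> * of_real v"
      using div[OF z] by (simp add: st uv split(1)[of z] algebra_simps)
    have "cnj ((cnj z - a) * g (cnj z)) = cnj (F (cnj z) - w)"
      using div[OF W(2)[OF z]] by simp
    then have 2: "(z - of_real s + \<i> * of_real t) * (g1 z - \<i> * g2 z) = F z - of_real u + \<i> * of_real v"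
      using F z split(2)[of z] by (simp add: st uv real_hol_def algebra_simps)
    have "2 * (F z - of_real u) = (F z - of_real u - \<i> * of_real v) + (F z - of_real u + \<i> * of_real v)"
      by simp
    also have "\<dots> = 2 * ((z - of_real s) * g1 z + of_real t * g2 z)"
      unfolding 1[symmetric] 2[symmetric] by (simp add: algebra_simps)
    finally have "F z - of_real u = (z - of_real s) * g1 z + of_real t * g2 z"
      by (metis mult_cancel_left zero_neq_numeral)
    then show "F z = of_real u + ((z + of_real (- s)) * g1 z + of_real t * g2 z)"
      by (simp add: algebra_simps)
    have "2 * \<i> * of_real (- v) = (F z - of_real u - \<i> * of_real v) - (F z - of_real u + \<i> * of_real v)"
      by simp
    also have "\<dots> = 2 * \<i> * ((z - of_real s) * g2 z - of_real t * g1 z)"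
      unfolding 1[symmetric] 2[symmetric] by (simp add: algebra_simps)
    finally have "of_real (- v) = (z - of_real s) * g2 z - of_real t * g1 z"
      by (simp del: of_real_minus)
    then show "of_real (- v) = (z + of_real (- s)) * g2 z + of_real (- t) * g1 z"
      by simp
  qed
  note mem = real_hol_add real_hol_mult real_hol_const real_hol_id g12 F
  have "\<psi> F p = \<psi> (\<lambda>z. of_real u + ((z + of_real (- s)) * g1 z + of_real t * g2 z)) p"
    by (intro cong mem eqs p)
  also have "\<dots> = of_real u + ((a + of_real (- s)) * \<psi> g1 p + of_real t * \<psi> g2 p)"
    by (simp only: add[OF _ _ p] mult[OF _ _ p] const[OF p] mem a)
  finally have 1: "\<psi> F p = of_real u + (\<i> * of_real t * \<psi> g1 p + of_real t * \<psi> g2 p)"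
    by (simp add: st)
  have "of_real (- v) = \<psi> (\<lambda>z. of_real (- v)) p"
    by (rule const[OF p, symmetric])
  also have "\<dots> = \<psi> (\<lambda>z. (z + of_real (- s)) * g2 z + of_real (- t) * g1 z) p"
    by (intro cong mem eqs p)
  also have "\<dots> = (a + of_real (- s)) * \<psi> g2 p + of_real (- t) * \<psi> g1 p"
    by (simp only: add[OF _ _ p] mult[OF _ _ p] const[OF p] mem a)
  finally have 2: "of_real (- v) = \<i> * of_real t * \<psi> g2 p - of_real t * \<psi> g1 p"
    by (simp add: st)
  have "\<i> * of_real v = - \<i> * (of_real (- v))" by simp
  also have "\<dots> = \<i> * of_real t * \<psi> g1 p + of_real t * \<psi> g2 p"
    unfolding 2 by (simp add: algebra_simps)
  finally show ?thesis
    unfolding 1 uv by simp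
qed

text \<open>Outside \<open>W\<close> the function \<open>z - a\<close> would be invertible, so that the character would kill 1.\<close>
lemma hom_id_in_range:
  assumes "p \<in> V"
  shows "\<psi> (\<lambda>z. z) p \<in> W"
proof (rule ccontr)
  let ?a = "\<psi> (\<lambda>z. z) p"
  assume a: "?a \<notin> W"
  have "\<psi> (\<lambda>z. of_real 1) p = 0"
  proof (rule hom_of_division[OF real_hol_const _ assms refl])
    show "(\<lambda>z. 1 / (z - ?a)) holomorphic_on W"
      using a by (auto intro!: holomorphic_intros)
    show "(z - ?a) * (1 / (z - ?a)) = of_real 1 - 0" if "z \<in> W" for z
      using a that by auto
  qed
  then show False using const[OF assms, of 1] by simp
qed

lemma hom_eq_composition:
  assumes F: "F \<in> real_hol W" and p: "p \<in> V"
  shows "\<psi> F p = F (\<psi> (\<lambda>z. z) p)"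
proof (rule hom_of_division[OF F _ p refl])
  let ?a = "\<psi> (\<lambda>z. z) p"
  show "(\<lambda>z. if z = ?a then deriv F ?a else (F z - F ?a) / (z - ?a)) holomorphic_on W"
    using F W by (intro pole_lemma_open) (auto simp: real_hol_def)
  show "(z - ?a) * (if z = ?a then deriv F ?a else (F z - F ?a) / (z - ?a)) = F z - F ?a" for z
    by simp
qed

end

section \<open>Slices of the quaternions\<close>

lemma imag_units_iff: "I \<in> imag_units \<longleftrightarrow> qre I = 0 \<and> (qi I)\<^sup>2 + (qj I)\<^sup>2 + (qk I)\<^sup>2 = 1"
proof -
  have sq: "I \<in> imag_units \<longleftrightarrow> qre I * qre I - qi I * qi I - qj I * qj I - qk I * qk I = - 1 \<and>
    (qre I = 0 \<or> qi I = 0 \<and> qj I = 0 \<and> qk I = 0)"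
    by (auto simp: imag_units_def power2_eq_square quat_eq_iff)
  moreover have "qre I * qre I \<noteq> - 1"
    by (metis zero_le_square not_one_le_zero neg_0_le_iff_le)
  ultimately show ?thesis
    by (auto simp: power2_eq_square)
qed

definition slice_emb :: "quat \<Rightarrow> complex \<Rightarrow> quat" where
  "slice_emb I z = slice_pt I (Re z) (Im z)"

text \<open>On the slice of \<open>I\<close> this inverts \<open>slice_emb I\<close>; on all quaternions it is the orthogonal projection
  to that slice.\<close>
definition slice_coord :: "quat \<Rightarrow> quat \<Rightarrow> complex" where
  "slice_coord I q = Complex (qre q) (q \<bullet> I)"

lemma slice_pt_eq_emb: "slice_pt I x y = slice_emb I (Complex x y)"
  by (simp add: slice_emb_def)

lemma slice_plane_eq_range: "slice_plane I = range (slice_emb I)"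
  unfolding slice_plane_def slice_emb_def
  by (auto simp: image_iff) (metis complex.sel)

lemma slice_emb_sel:
  "qre (slice_emb I z) = Re z + qre I * Im z" "qi (slice_emb I z) = qi I * Im z"
  "qj (slice_emb I z) = qj I * Im z" "qk (slice_emb I z) = qk I * Im z"
  by (simp_all add: slice_emb_def slice_pt_def)

lemma slice_emb_of_real [simp]: "slice_emb I (of_real x) = of_real x"
  by (simp add: quat_eq_iff slice_emb_sel)

lemma slice_emb_simps [simp]: "slice_emb I 0 = 0" "slice_emb I 1 = 1"
  by (simp_all add: quat_eq_iff slice_emb_sel)

lemma slice_emb_add: "slice_emb I (z + w) = slice_emb I z + slice_emb I w"
  by (simp add: quat_eq_iff slice_emb_sel algebra_simps)

lemma slice_emb_scaleR: "slice_emb I (r *\<^sub>R z) = r *\<^sub>R slice_emb I z"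
  by (simp add: quat_eq_iff slice_emb_sel algebra_simps)

lemma bounded_linear_slice_emb: "bounded_linear (slice_emb I)"
  unfolding linear_conv_bounded_linear[symmetric]
  by (intro linearI slice_emb_add slice_emb_scaleR)

lemma slice_emb_mult:
  assumes "I \<in> imag_units"
  shows "slice_emb I (z * w) = slice_emb I z * slice_emb I w"
proof -
  have "I * I = - 1" using assms by (simp add: imag_units_def power2_eq_square)
  then have [simp]: "I * (I * q) = - q" for q by (metis mult.assoc mult_minus1)
  show ?thesis
    unfolding slice_emb_def slice_pt_def
    using \<open>I * I = - 1\<close> by (simp add: of_real_def algebra_simps)
qed

lemma slice_coord_emb:
  assumes "I \<in> imag_units"
  shows "slice_coord I (slice_emb I z) = z"
proof -
  have "qi I * Im z * qi I + qj I * Im z * qj I + qk I * Im z * qk I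
      = Im z * ((qi I)\<^sup>2 + (qj I)\<^sup>2 + (qk I)\<^sup>2)"
    by (simp add: power2_eq_square algebra_simps)
  then show ?thesis
    using assms by (simp add: slice_coord_def inner_quat_def slice_emb_sel imag_units_iff)
qed

lemma slice_emb_inject: "I \<in> imag_units \<Longrightarrow> slice_emb I z = slice_emb I w \<longleftrightarrow> z = w"
  by (metis slice_coord_emb)

lemma slice_emb_divide:
  assumes I: "I \<in> imag_units"
  shows "slice_emb I (z / w) = slice_emb I z / slice_emb I w"
proof (cases "w = 0")
  case False
  have "slice_emb I (z / w) * slice_emb I w = slice_emb I z"
    using False by (simp flip: slice_emb_mult[OF I])
  moreover have "slice_emb I w \<noteq> 0"
    using False slice_emb_inject[OF I, of w 0] by simp
  ultimately show ?thesis by (simp add: eq_divide_eq)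
qed simp

lemma slice_emb_uminus_unit: "I \<in> imag_units \<Longrightarrow> slice_emb (- I) z = slice_emb I (cnj z)"
  by (simp add: quat_eq_iff slice_emb_sel imag_units_iff)

lemma uminus_imag_unit: "I \<in> imag_units \<Longrightarrow> - I \<in> imag_units"
  by (simp add: imag_units_iff)

lemma bounded_linear_slice_coord: "bounded_linear (slice_coord I)"
  unfolding linear_conv_bounded_linear[symmetric]
  by (intro linearI) (simp_all add: slice_coord_def complex_eq_iff inner_add_left)

text \<open>This makes \<open>slice_coord I\<close> turn the Cauchy-Riemann equation of a regular function, whatever its
  values, into the complex one.\<close>
lemma slice_coord_unit_mult:
  assumes "I \<in> imag_units"
  shows "slice_coord I (I * q) = \<i> * slice_coord I q"
proof -
  have I: "qre I = 0" "(qi I)\<^sup>2 + (qj I)\<^sup>2 + (qk I)\<^sup>2 = 1"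
    using assms by (simp_all add: imag_units_iff)
  have "(I * q) \<bullet> I = qre q * ((qi I)\<^sup>2 + (qj I)\<^sup>2 + (qk I)\<^sup>2)"
    by (simp add: inner_quat_def I(1) power2_eq_square algebra_simps)
  then have "(I * q) \<bullet> I = qre q" by (simp add: I(2))
  then show ?thesis
    by (simp add: slice_coord_def complex_eq_iff I(1)) (simp add: inner_quat_def I(1) mult.commute)
qed

lemma norm_imag_unit: "I \<in> imag_units \<Longrightarrow> norm I = 1"
  by (simp add: norm_quat_def inner_quat_def imag_units_iff power2_eq_square)

definition std_unit :: quat where
  "std_unit = Quat 0 1 0 0"

lemma std_unit: "std_unit \<in> imag_units"
  by (simp add: std_unit_def imag_units_iff)

definition polar_coord :: "quat \<Rightarrow> complex" where
  "polar_coord q = Complex (qre q) (norm (q - of_real (qre q)))"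

text \<open>Together with \<open>polar_coord\<close> this writes a quaternion as \<open>x + I y\<close> with \<open>y \<ge> 0\<close>. At real quaternions,
  where \<open>y = 0\<close>, the choice of \<open>I\<close> is arbitrary.\<close>
definition polar_unit :: "quat \<Rightarrow> quat" where
  "polar_unit q = (if q = of_real (qre q) then std_unit
     else (q - of_real (qre q)) /\<^sub>R norm (q - of_real (qre q)))"

lemma polar_unit: "polar_unit q \<in> imag_units"
proof (cases "q = of_real (qre q)")
  case False
  define v where "v = q - of_real (qre q)"
  have "v \<noteq> 0" "qre v = 0" using False by (simp_all add: v_def)
  then have "(norm v)\<^sup>2 = (qi v)\<^sup>2 + (qj v)\<^sup>2 + (qk v)\<^sup>2"
    by (simp add: norm_quat_def inner_quat_def power2_eq_square)
  moreover have "norm v \<noteq> 0" using \<open>v \<noteq> 0\<close> by simp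
  ultimately have "(qi v)\<^sup>2 / (norm v)\<^sup>2 + (qj v)\<^sup>2 / (norm v)\<^sup>2 + (qk v)\<^sup>2 / (norm v)\<^sup>2 = 1"
    by (metis add_divide_distrib divide_self power_not_zero)
  then have "v /\<^sub>R norm v \<in> imag_units"
    using \<open>qre v = 0\<close> by (simp add: imag_units_iff power_mult_distrib divide_inverse power_inverse mult.commute)
  then show ?thesis
    using False by (simp add: polar_unit_def v_def)
qed (simp add: polar_unit_def std_unit)

lemma slice_emb_polar: "slice_emb (polar_unit q) (polar_coord q) = q"
proof (cases "q = of_real (qre q)")
  case True
  then have "polar_coord q = of_real (qre q)" by (simp add: polar_coord_def complex_eq_iff)
  then show ?thesis using True by simp
next
  case False
  then show ?thesis
    by (simp add: polar_unit_def polar_coord_def slice_emb_def slice_pt_def of_real_def)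
qed

lemma polar_of_emb:
  assumes I: "I \<in> imag_units"
  shows "Im z = 0 \<Longrightarrow> polar_coord (slice_emb I z) = z"
    and "Im z > 0 \<Longrightarrow> polar_unit (slice_emb I z) = I \<and> polar_coord (slice_emb I z) = z"
    and "Im z < 0 \<Longrightarrow> polar_unit (slice_emb I z) = - I \<and> polar_coord (slice_emb I z) = cnj z"
proof -
  have re: "qre (slice_emb I z) = Re z"
    using I by (simp add: slice_emb_sel imag_units_iff)
  have v: "slice_emb I z - of_real (Re z) = Im z *\<^sub>R I"
    by (simp add: slice_emb_def slice_pt_def of_real_def)
  have n: "norm (slice_emb I z - of_real (Re z)) = \<bar>Im z\<bar>"
    using norm_imag_unit[OF I] by (simp add: v)
  have nz: "slice_emb I z \<noteq> of_real (Re z)" if "Im z \<noteq> 0"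
    using n that by auto
  show "Im z = 0 \<Longrightarrow> polar_coord (slice_emb I z) = z"
    by (simp add: polar_coord_def re n complex_eq_iff)
  show "Im z > 0 \<Longrightarrow> polar_unit (slice_emb I z) = I \<and> polar_coord (slice_emb I z) = z"
    using nz by (simp add: polar_coord_def polar_unit_def re v norm_imag_unit[OF I] complex_eq_iff)
  show "Im z < 0 \<Longrightarrow> polar_unit (slice_emb I z) = - I \<and> polar_coord (slice_emb I z) = cnj z"
    using nz by (simp add: polar_coord_def polar_unit_def re v norm_imag_unit[OF I] complex_eq_iff)
qed

text \<open>For a symmetric slice domain every other imaginary unit gives the same set.\<close>
definition slice_trace :: "quat set \<Rightarrow> complex set" where
  "slice_trace D = {z. slice_emb std_unit z \<in> D}"

lemma slice_emb_mem_iff: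
  assumes "symmetric_slice_domain D" "I \<in> imag_units"
  shows "slice_emb I z \<in> D \<longleftrightarrow> z \<in> slice_trace D"
  using assms std_unit unfolding symmetric_slice_domain_def slice_trace_def slice_emb_def mem_Collect_eq by blast

lemma slice_trace_cnj:
  assumes "symmetric_slice_domain D" "z \<in> slice_trace D"
  shows "cnj z \<in> slice_trace D"
  using slice_emb_mem_iff[OF assms(1) uminus_imag_unit[OF std_unit], of z] assms(2)
  by (simp add: slice_emb_uminus_unit std_unit slice_trace_def)

lemma polar_coord_mem:
  assumes "symmetric_slice_domain D" "q \<in> D"
  shows "polar_coord q \<in> slice_trace D"
  using slice_emb_mem_iff[OF assms(1) polar_unit[of q], of "polar_coord q"] assms(2)
  by (simp add: slice_emb_polar)

lemma slice_trace_domain: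
  assumes "symmetric_slice_domain D"
  shows "open (slice_trace D)" "connected (slice_trace D)" "\<exists>x. of_real x \<in> slice_trace D"
proof -
  have "open D" using assms by (simp add: symmetric_slice_domain_def domain_in_def openin_open)
  then show "open (slice_trace D)"
    unfolding slice_trace_def
    using open_vimage[OF _ linear_continuous_on[OF bounded_linear_slice_emb]] by (simp add: vimage_def)
  have "slice_trace D = slice_coord std_unit ` (D \<inter> slice_plane std_unit)"
    unfolding slice_plane_eq_range slice_trace_def
    by (force simp: slice_coord_emb[OF std_unit] image_iff)
  moreover have "connected (D \<inter> slice_plane std_unit)"
    using assms std_unit by (simp add: symmetric_slice_domain_def domain_in_def)
  ultimately show "connected (slice_trace D)"
    by (simp add: connected_continuous_image linear_continuous_on[OF bounded_linear_slice_coord])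
  obtain x where "of_real x \<in> D"
    using assms by (auto simp: symmetric_slice_domain_def Reals_def)
  then show "\<exists>x. of_real x \<in> slice_trace D"
    by (auto simp: slice_trace_def intro!: exI[of _ x])
qed

section \<open>Slice preserving regular functions as real holomorphic functions\<close>

text \<open>The slice function with stem \<open>F\<close>. Evaluating \<open>F\<close> in the closed upper half plane only makes this well
  defined; for \<open>F\<close> in \<open>real_hol\<close> the symmetry then gives the same formula on all of each slice.\<close>
definition slice_fun :: "quat set \<Rightarrow> (complex \<Rightarrow> complex) \<Rightarrow> quat \<Rightarrow> quat" where
  "slice_fun D F = (\<lambda>q\<in>D. slice_emb (polar_unit q) (F (polar_coord q)))"

definition stem :: "(quat \<Rightarrow> quat) \<Rightarrow> complex \<Rightarrow> complex" where
  "stem f z = slice_coord std_unit (f (slice_emb std_unit z))"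

text \<open>At a point \<open>x - I y\<close> below the axis the polar form uses the unit \<open>- I\<close> and the point \<open>cnj z\<close>, and the
  two sign changes cancel by the symmetry of \<open>F\<close>. At a real point the arbitrary unit in the polar form
  is harmless, as \<open>F\<close> is real there.\<close>
lemma slice_fun_emb:
  assumes D: "symmetric_slice_domain D" and F: "F \<in> real_hol (slice_trace D)"
    and I: "I \<in> imag_units" and z: "z \<in> slice_trace D"
  shows "slice_fun D F (slice_emb I z) = slice_emb I (F z)"
proof -
  have "slice_emb I z \<in> D" using slice_emb_mem_iff[OF D I] z by simp
  then have eq: "slice_fun D F (slice_emb I z) =
      slice_emb (polar_unit (slice_emb I z)) (F (polar_coord (slice_emb I z)))"
    by (simp add: slice_fun_def)
  consider "Im z = 0" | "Im z > 0" | "Im z < 0" by linarith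
  then show ?thesis
  proof cases
    case 1
    then have "F z = of_real (Re (F z))"
      using real_hol_real[OF F z] by (simp add: complex_eq_iff)
    then show ?thesis
      unfolding eq polar_of_emb(1)[OF I 1] by (metis slice_emb_of_real)
  next
    case 2
    then show ?thesis using polar_of_emb(2)[OF I 2] by (simp add: eq)
  next
    case 3
    have "F (cnj z) = cnj (F z)" using F z by (simp add: real_hol_def)
    then show ?thesis
      using polar_of_emb(3)[OF I 3] by (simp add: eq slice_emb_uminus_unit[OF I])
  qed
qed

lemma stem_slice_fun:
  assumes "symmetric_slice_domain D" "F \<in> real_hol (slice_trace D)" "z \<in> slice_trace D"
  shows "stem (slice_fun D F) z = F z"
  using slice_fun_emb[OF assms(1,2) std_unit assms(3)] by (simp add: stem_def slice_coord_emb std_unit)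

lemma regular_on_slice_fun:
  assumes D: "symmetric_slice_domain D" and F: "F \<in> real_hol (slice_trace D)"
  shows "regular_on D (slice_fun D F)"
  unfolding regular_on_def
proof
  fix I assume I: "I \<in> imag_units"
  let ?W = "slice_trace D" and ?S = "{(x, y). slice_pt I x y \<in> D}"
  have W: "open ?W" by (rule slice_trace_domain[OF D])
  have hol: "F holomorphic_on ?W" using F by (simp add: real_hol_def)
  have mem: "slice_pt I x y \<in> D \<longleftrightarrow> Complex x y \<in> ?W" for x y
    using slice_emb_mem_iff[OF D I] by (simp add: slice_pt_eq_emb)
  have "deriv F holomorphic_on ?W" by (rule holomorphic_deriv[OF hol W])
  then have cd: "continuous_on ?W (deriv F)" by (rule holomorphic_on_imp_continuous_on)
  have cont: "continuous_on ?S (\<lambda>(x, y). deriv F (Complex x y))"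
    unfolding case_prod_beta
    by (rule continuous_on_compose2[OF cd]) (auto simp: mem intro!: continuous_intros simp flip: complex_of_real_def)
  have near: "\<forall>\<^sub>F t in nhds x. Complex t y \<in> ?W" "\<forall>\<^sub>F t in nhds y. Complex x t \<in> ?W"
    if "Complex x y \<in> ?W" for x y
  proof -
    have "((\<lambda>t. Complex t y) \<longlongrightarrow> Complex x y) (nhds x)" "((\<lambda>t. Complex x t) \<longlongrightarrow> Complex x y) (nhds y)"
      by (intro tendsto_Complex tendsto_const filterlim_ident)+
    then show "\<forall>\<^sub>F t in nhds x. Complex t y \<in> ?W" "\<forall>\<^sub>F t in nhds y. Complex x t \<in> ?W"
      using topological_tendstoD[OF _ W that] by blast+
  qed
  note bl = bounded_linear.has_vector_derivative[OF bounded_linear_slice_emb]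
  define fx where "fx = (\<lambda>(x, y). slice_emb I (deriv F (Complex x y)))"
  define fy where "fy = (\<lambda>(x, y). slice_emb I (\<i> * deriv F (Complex x y)))"
  show "\<exists>fx fy. continuous_on ?S fx \<and> continuous_on ?S fy \<and> (\<forall>x y. slice_pt I x y \<in> D \<longrightarrow>
      ((\<lambda>t. slice_fun D F (slice_pt I t y)) has_vector_derivative fx (x, y)) (at x) \<and>
      ((\<lambda>t. slice_fun D F (slice_pt I x t)) has_vector_derivative fy (x, y)) (at y) \<and>
      (1/2) *\<^sub>R (fx (x, y) + I * fy (x, y)) = 0)"
  proof (rule exI[of _ fx], rule exI[of _ fy], intro conjI allI impI)
    show "continuous_on ?S fx" "continuous_on ?S fy"
      using cont unfolding fx_def fy_def case_prod_beta
      by (auto intro!: continuous_intros bounded_linear.continuous_on[OF bounded_linear_slice_emb])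
  next
    fix x y assume "slice_pt I x y \<in> D"
    then have xy: "Complex x y \<in> ?W" by (simp add: mem)
    then have dF: "(F has_field_derivative deriv F (Complex x y)) (at (Complex x y))"
      using hol W holomorphic_derivI by blast
    have "((\<lambda>t. Complex t y) has_vector_derivative 1) (at x)"
      "((\<lambda>t. Complex x t) has_vector_derivative \<i>) (at y)"
      by (auto simp: Complex_eq intro!: derivative_eq_intros)
    from this[THEN field_vector_diff_chain_at] dF
    have dx: "((\<lambda>t. F (Complex t y)) has_vector_derivative deriv F (Complex x y)) (at x)"
      and dy: "((\<lambda>t. F (Complex x t)) has_vector_derivative \<i> * deriv F (Complex x y)) (at y)"
      by (fastforce simp: o_def)+
    from near(1)[OF xy] obtain S where S: "open S" "x \<in> S" "\<And>t. t \<in> S \<Longrightarrow> Complex t y \<in> ?W"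
      unfolding eventually_nhds by blast
    show "((\<lambda>t. slice_fun D F (slice_pt I t y)) has_vector_derivative fx (x, y)) (at x)"
      unfolding fx_def case_prod_conv
      by (rule has_vector_derivative_transform_within_open[OF bl[OF dx] S(1,2)])
         (simp add: S(3) slice_pt_eq_emb slice_fun_emb[OF D F I])
    from near(2)[OF xy] obtain S where S: "open S" "y \<in> S" "\<And>t. t \<in> S \<Longrightarrow> Complex x t \<in> ?W"
      unfolding eventually_nhds by blast
    show "((\<lambda>t. slice_fun D F (slice_pt I x t)) has_vector_derivative fy (x, y)) (at y)"
      unfolding fy_def case_prod_conv
      by (rule has_vector_derivative_transform_within_open[OF bl[OF dy] S(1,2)])
         (simp add: S(3) slice_pt_eq_emb slice_fun_emb[OF D F I])
    have "I = slice_emb I \<i>" by (simp add: slice_emb_def slice_pt_def)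
    then have "I * fy (x, y) = slice_emb I (\<i> * (\<i> * deriv F (Complex x y)))"
      unfolding fy_def case_prod_conv slice_emb_mult[OF I, of \<i> "\<i> * _"] by simp
    also have "\<dots> = - fx (x, y)"
      unfolding fx_def by (simp add: bounded_linear.linear[OF bounded_linear_slice_emb] linear_neg)
    finally show "(1/2) *\<^sub>R (fx (x, y) + I * fy (x, y)) = 0" by simp
  qed
qed

lemma slice_fun_carrier:
  assumes D: "symmetric_slice_domain D" and F: "F \<in> real_hol (slice_trace D)"
  shows "slice_fun D F \<in> carrier (slice_alg D)"
proof -
  have "slice_preserving_on D (slice_fun D F)"
    unfolding slice_preserving_on_def slice_plane_eq_range
    using slice_emb_mem_iff[OF D] slice_fun_emb[OF D F] by auto
  then show ?thesis
    using regular_on_slice_fun[OF assms] by (simp add: slice_alg_def slice_fun_def)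
qed

text \<open>Continuous partial derivatives give total differentiability, and the Cauchy-Riemann equation makes
  the derivative complex linear.\<close>
lemma regular_slice_coord_holomorphic:
  assumes D: "symmetric_slice_domain D" and f: "regular_on D f" and I: "I \<in> imag_units"
  shows "(\<lambda>z. slice_coord I (f (slice_emb I z))) holomorphic_on slice_trace D"
proof -
  let ?W = "slice_trace D" and ?S = "{(x, y). slice_pt I x y \<in> D}"
  let ?f = "\<lambda>x y. slice_coord I (f (slice_pt I x y))"
  have W: "open ?W" by (rule slice_trace_domain[OF D])
  have mem: "slice_pt I x y \<in> D \<longleftrightarrow> Complex x y \<in> ?W" for x y
    using slice_emb_mem_iff[OF D I] by (simp add: slice_pt_eq_emb)
  from bspec[OF f[unfolded regular_on_def] I] obtain fx fy where cont: "continuous_on ?S fy"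
    and all: "\<forall>x y. slice_pt I x y \<in> D \<longrightarrow>
      ((\<lambda>t. f (slice_pt I t y)) has_vector_derivative fx (x, y)) (at x) \<and>
      ((\<lambda>t. f (slice_pt I x t)) has_vector_derivative fy (x, y)) (at y) \<and>
      (1/2) *\<^sub>R (fx (x, y) + I * fy (x, y)) = 0"
    by (elim exE conjE) (rule that)
  from all have part:
      "\<And>x y. slice_pt I x y \<in> D \<Longrightarrow> ((\<lambda>t. f (slice_pt I t y)) has_vector_derivative fx (x, y)) (at x)"
      "\<And>x y. slice_pt I x y \<in> D \<Longrightarrow> ((\<lambda>t. f (slice_pt I x t)) has_vector_derivative fy (x, y)) (at y)"
    and CR: "\<And>x y. slice_pt I x y \<in> D \<Longrightarrow> (1/2) *\<^sub>R (fx (x, y) + I * fy (x, y)) = 0"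
    by simp_all
  note bl = bounded_linear.has_vector_derivative[OF bounded_linear_slice_coord]
  have "open ?S"
  proof -
    have "?S = (\<lambda>p. Complex (fst p) (snd p)) -` ?W" by (auto simp: mem)
    then show ?thesis
      using W by (auto intro!: open_vimage continuous_intros simp: Complex_eq)
  qed
  have "\<exists>d. ((\<lambda>z. slice_coord I (f (slice_emb I z))) has_field_derivative d) (at z)" if z: "z \<in> ?W" for z
  proof -
    define x where "x = Re z" define y where "y = Im z"
    have "(x, y) \<in> ?S" using z by (simp add: mem x_def y_def)
    then obtain X Y where XY: "open X" "open Y" "x \<in> X" "y \<in> Y" "X \<times> Y \<subseteq> ?S"
      using \<open>open ?S\<close> open_prod_elim by (metis mem_Sigma_iff)
    from XY obtain e1 e2 where "e1 > 0" "ball x e1 \<subseteq> X" "e2 > 0" "ball y e2 \<subseteq> Y"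
      by (meson open_contains_ball)
    then have e: "min e1 e2 > 0" "ball x (min e1 e2) \<subseteq> X" "ball y (min e1 e2) \<subseteq> Y"
      by auto
    define e where "e = min e1 e2"
    note e = e[folded e_def]
    let ?a = "slice_coord I (fx (x, y))" and ?b = "\<lambda>x y. slice_coord I (fy (x, y))"
    have inS: "(s, t) \<in> ?S" if "s \<in> ball x e" "t \<in> ball y e" for s t
      using e XY(5) that by blast
    have "((\<lambda>(s, t). ?f s t) has_derivative (\<lambda>(tx, ty). tx *\<^sub>R ?a + blinfun_scaleR_left (?b x y) ty))
        (at (x, y) within ball x e \<times> ball y e)"
    proof (rule has_derivative_partialsI)
      show "((\<lambda>s. ?f s y) has_derivative (\<lambda>tx. tx *\<^sub>R ?a)) (at x within ball x e)"
        using bl[OF part(1)[of x y]] inS[of x y] e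
        by (auto simp: has_vector_derivative_def intro: has_derivative_at_withinI)
      show "((\<lambda>t. ?f s t) has_derivative blinfun_apply (blinfun_scaleR_left (?b s t))) (at t within ball y e)"
        if "s \<in> ball x e" "t \<in> ball y e" for s t
        using bl[OF part(2)[of s t]] inS[OF that]
        by (auto simp: has_vector_derivative_def intro: has_derivative_at_withinI)
      have "continuous_on (ball x e \<times> ball y e) fy"
        using inS by (intro continuous_on_subset[OF cont]) auto
      then have "continuous_on (ball x e \<times> ball y e) (\<lambda>p. blinfun_scaleR_left (slice_coord I (fy p)))"
        by (intro bounded_linear.continuous_on[OF bounded_linear_blinfun_scaleR_left]
          bounded_linear.continuous_on[OF bounded_linear_slice_coord])
      then show "continuous (at (x, y) within ball x e \<times> ball y e) (\<lambda>(s, t). blinfun_scaleR_left (?b s t))"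
        using e by (simp add: continuous_on_eq_continuous_within case_prod_unfold)
    qed (use e in auto)
    moreover have "at (x, y) within ball x e \<times> ball y e = at (x, y)"
      using e by (intro at_within_open) (auto simp: open_Times)
    ultimately have der: "((\<lambda>(s, t). ?f s t) has_derivative (\<lambda>(tx, ty). tx *\<^sub>R ?a + ty *\<^sub>R ?b x y)) (at (x, y))"
      by simp
    have "fx (x, y) + I * fy (x, y) = 0"
      using CR[of x y] \<open>(x, y) \<in> ?S\<close> by simp
    then have "slice_coord I (fx (x, y) + I * fy (x, y)) = 0"
      by (simp add: slice_coord_def complex_eq_iff)
    then have "?a + \<i> * ?b x y = 0"
      by (simp add: slice_coord_unit_mult[OF I] linear_add[OF bounded_linear.linear[OF bounded_linear_slice_coord]])
    then have "\<i> * (?a + \<i> * ?b x y) = 0" by simp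
    then have ab: "?b x y = \<i> * ?a" by (simp add: algebra_simps)
    have "((\<lambda>z. (Re z, Im z)) has_derivative (\<lambda>z. (Re z, Im z))) (at z)"
      by (intro has_derivative_Pair bounded_linear_imp_has_derivative bounded_linear_Re bounded_linear_Im)
    from diff_chain_at[OF this der[unfolded x_def y_def]]
    have "((\<lambda>z. slice_coord I (f (slice_emb I z))) has_derivative (\<lambda>h. Re h *\<^sub>R ?a + Im h *\<^sub>R ?b x y)) (at z)"
      by (simp add: o_def x_def y_def slice_emb_def)
    moreover have "(\<lambda>h. Re h *\<^sub>R ?a + Im h *\<^sub>R ?b x y) = (*) ?a"
      unfolding ab by (auto simp: complex_eq_iff fun_eq_iff)
    ultimately show ?thesis
      by (auto simp: has_field_derivative_def)
  qed
  then show ?thesis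
    using W by (auto simp: holomorphic_on_open)
qed

text \<open>For each unit the slice coordinates of \<open>f\<close> give a holomorphic function on the trace. At a real point
  the value of \<open>f\<close> lies in all slice planes and is therefore real, so that these holomorphic functions
  agree on the real points, and hence everywhere.\<close>
lemma slice_alg_emb:
  assumes D: "symmetric_slice_domain D" and f: "f \<in> carrier (slice_alg D)"
    and I: "I \<in> imag_units" and z: "z \<in> slice_trace D"
  shows "f (slice_emb I z) = slice_emb I (stem f z)"
proof -
  let ?W = "slice_trace D"
  let ?F = "\<lambda>I z. slice_coord I (f (slice_emb I z))"
  have reg: "regular_on D f" and sp: "slice_preserving_on D f"
    using f by (simp_all add: slice_alg_def)
  note W = slice_trace_domain[OF D]
  have range: "f (slice_emb J w) \<in> range (slice_emb J)" if "J \<in> imag_units" "w \<in> ?W" for J w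
    using sp that slice_emb_mem_iff[OF D] unfolding slice_preserving_on_def slice_plane_eq_range by blast
  have eq: "f (slice_emb J w) = slice_emb J (?F J w)" if "J \<in> imag_units" "w \<in> ?W" for J w
    using range[OF that] slice_coord_emb[OF that(1)] by force
  have real: "?F I (of_real x) - ?F std_unit (of_real x) = 0" if x: "of_real x \<in> ?W" for x
  proof -
    have J: "Quat 0 0 1 0 \<in> imag_units" by (simp add: imag_units_iff)
    have "f (of_real x) \<in> range (slice_emb std_unit)" "f (of_real x) \<in> range (slice_emb (Quat 0 0 1 0))"
      using range[OF std_unit x] range[OF J x] by simp_all
    then obtain v w where "f (of_real x) = slice_emb std_unit v" "f (of_real x) = slice_emb (Quat 0 0 1 0) w"
      by blast
    then have "qi (f (of_real x)) = 0" "qj (f (of_real x)) = 0" "qk (f (of_real x)) = 0"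
      using slice_emb_sel[of std_unit v] slice_emb_sel[of "Quat 0 0 1 0" w] by (simp_all add: std_unit_def)
    then have "f (of_real x) = of_real (qre (f (of_real x)))"
      by (simp add: quat_eq_iff)
    then obtain r where r: "f (of_real x) = of_real r" by blast
    then show ?thesis
      using slice_coord_emb[OF I, of "of_real r"] slice_coord_emb[OF std_unit, of "of_real r"] by simp
  qed
  obtain x where x: "of_real x \<in> ?W" using W(3) by blast
  then obtain e where e: "e > 0" "ball (of_real x) e \<subseteq> ?W"
    using W(1) open_contains_ball by blast
  have "?F I z - ?F std_unit z = 0"
  proof (rule analytic_continuation[OF _ W(1,2) _ x _ _ z, of _ "?W \<inter> range of_real"])
    show "(\<lambda>z. ?F I z - ?F std_unit z) holomorphic_on ?W"
      by (intro holomorphic_on_diff regular_slice_coord_holomorphic[OF D reg] I std_unit)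
    show "of_real x islimpt (?W \<inter> range of_real)"
    proof (unfold islimpt_approachable, intro allI impI)
      fix d :: real assume "d > 0"
      define y where "y = x + min d e / 2"
      have dy: "dist (of_real y :: complex) (of_real x) = min d e / 2"
        using \<open>d > 0\<close> e by (simp add: y_def dist_norm)
      then have "of_real y \<in> ball (of_real x :: complex) e" "y \<noteq> x"
        using \<open>d > 0\<close> e(1) by (auto simp: dist_commute y_def)
      then show "\<exists>y\<in>?W \<inter> range of_real. y \<noteq> of_real x \<and> dist y (of_real x) < d"
        using dy \<open>d > 0\<close> e by (intro bexI[of _ "of_real y"]) auto
    qed
  qed (use real in auto)
  then show ?thesis
    using eq[OF I z] by (simp add: stem_def)
qed

text \<open>The symmetry is the comparison of the slices of \<open>I\<close> and \<open>- I\<close>, which are the same set with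
  conjugate coordinates.\<close>
lemma stem_real_hol:
  assumes D: "symmetric_slice_domain D" and f: "f \<in> carrier (slice_alg D)"
  shows "stem f \<in> real_hol (slice_trace D)"
proof -
  have "stem f holomorphic_on slice_trace D"
    using regular_slice_coord_holomorphic[OF D _ std_unit] f
    by (simp add: stem_def[abs_def] slice_alg_def)
  moreover have "stem f (cnj z) = cnj (stem f z)" if z: "z \<in> slice_trace D" for z
  proof -
    have "slice_emb std_unit (stem f (cnj z)) = slice_emb std_unit (cnj (stem f z))"
      using slice_alg_emb[OF D f std_unit slice_trace_cnj[OF D z]]
        slice_alg_emb[OF D f uminus_imag_unit[OF std_unit] z]
      by (simp add: slice_emb_uminus_unit std_unit)
    then show ?thesis by (simp add: slice_emb_inject std_unit)
  qed
  ultimately show ?thesis by (simp add: real_hol_def)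
qed

lemma slice_fun_stem:
  assumes D: "symmetric_slice_domain D" and f: "f \<in> carrier (slice_alg D)"
  shows "slice_fun D (stem f) = f"
proof (rule extensionalityI)
  fix q assume q: "q \<in> D"
  show "slice_fun D (stem f) q = f q"
    using slice_alg_emb[OF D f polar_unit polar_coord_mem[OF D q], of q] q
    by (simp add: slice_fun_def slice_emb_polar)
qed (use f in \<open>auto simp: slice_fun_def slice_alg_def\<close>)

lemma slice_alg_carrier_eq:
  assumes "symmetric_slice_domain D"
  shows "carrier (slice_alg D) = slice_fun D ` real_hol (slice_trace D)"
proof
  show "carrier (slice_alg D) \<subseteq> slice_fun D ` real_hol (slice_trace D)"
    using slice_fun_stem[OF assms] stem_real_hol[OF assms] by (metis image_eqI subsetI)
qed (use slice_fun_carrier[OF assms] in auto)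

lemma slice_fun_eq_iff:
  assumes D: "symmetric_slice_domain D" and "F \<in> real_hol (slice_trace D)" "G \<in> real_hol (slice_trace D)"
  shows "slice_fun D F = slice_fun D G \<longleftrightarrow> (\<forall>z\<in>slice_trace D. F z = G z)"
proof
  assume "slice_fun D F = slice_fun D G"
  then show "\<forall>z\<in>slice_trace D. F z = G z"
    using stem_slice_fun[OF D] assms by metis
next
  assume "\<forall>z\<in>slice_trace D. F z = G z"
  then show "slice_fun D F = slice_fun D G"
    using polar_coord_mem[OF D] by (auto simp: slice_fun_def)
qed

lemma slice_fun_mult:
  "slice_fun D F \<otimes>\<^bsub>slice_alg D\<^esub> slice_fun D G = slice_fun D (\<lambda>z. F z * G z)"
  by (auto simp: slice_alg_def slice_fun_def slice_emb_mult polar_unit)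

lemma slice_fun_add:
  "slice_fun D F \<oplus>\<^bsub>slice_alg D\<^esub> slice_fun D G = slice_fun D (\<lambda>z. F z + G z)"
  by (auto simp: slice_alg_def slice_fun_def slice_emb_add)

lemma slice_fun_smult:
  "r \<odot>\<^bsub>slice_alg D\<^esub> slice_fun D F = slice_fun D (\<lambda>z. of_real r * F z)"
  by (auto simp: slice_alg_def slice_fun_def slice_emb_scaleR simp flip: scaleR_conv_of_real)

lemma slice_alg_one: "\<one>\<^bsub>slice_alg D\<^esub> = slice_fun D (\<lambda>z. of_real 1)"
  by (auto simp: slice_alg_def slice_fun_def)

lemma slice_alg_zero: "\<zero>\<^bsub>slice_alg D\<^esub> = slice_fun D (\<lambda>z. of_real 0)"
  by (auto simp: slice_alg_def slice_fun_def)

lemmas slice_fun_ops = slice_fun_mult slice_fun_add slice_fun_smult slice_alg_one slice_alg_zero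

lemma domain_slice_alg:
  assumes D: "symmetric_slice_domain D"
  shows "domain (slice_alg D)"
proof -
  let ?W = "slice_trace D"
  note carr = slice_alg_carrier_eq[OF D] and W = slice_trace_domain[OF D]
  interpret cring "slice_alg D"
  proof (rule cringI)
    show "abelian_group (slice_alg D)"
    proof (rule abelian_groupI)
      fix x assume "x \<in> carrier (slice_alg D)"
      then obtain F where F: "F \<in> real_hol ?W" "x = slice_fun D F" unfolding carr by auto
      then have "slice_fun D (\<lambda>z. of_real (- 1) * F z) \<in> carrier (slice_alg D)"
        unfolding carr by (intro imageI real_hol_mult real_hol_const)
      then show "\<exists>y\<in>carrier (slice_alg D). y \<oplus>\<^bsub>slice_alg D\<^esub> x = \<zero>\<^bsub>slice_alg D\<^esub>"
        by (rule bexI[rotated]) (simp add: F slice_fun_ops)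
    qed (auto simp: carr slice_fun_ops algebra_simps intro!: imageI real_hol_zero real_hol_add)
    show "comm_monoid (slice_alg D)"
      by (rule comm_monoidI)
         (auto simp: carr slice_fun_ops algebra_simps intro!: imageI real_hol_one real_hol_mult)
  qed (auto simp: carr slice_fun_ops algebra_simps)
  show ?thesis
  proof
    obtain x where "of_real x \<in> ?W" using W(3) by blast
    then show "\<one>\<^bsub>slice_alg D\<^esub> \<noteq> \<zero>\<^bsub>slice_alg D\<^esub>"
      unfolding slice_fun_ops slice_fun_eq_iff[OF D real_hol_const real_hol_const] by auto
  next
    fix a b assume ab: "a \<otimes>\<^bsub>slice_alg D\<^esub> b = \<zero>\<^bsub>slice_alg D\<^esub>"
      "a \<in> carrier (slice_alg D)" "b \<in> carrier (slice_alg D)"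
    then obtain F G where FG: "F \<in> real_hol ?W" "a = slice_fun D F" "G \<in> real_hol ?W" "b = slice_fun D G"
      unfolding carr by auto
    have "\<forall>z\<in>?W. F z * G z = of_real 0"
      using ab(1) unfolding FG slice_fun_ops using slice_fun_eq_iff[OF D real_hol_mult[OF FG(1,3)] real_hol_const] by blast
    then have "\<forall>z\<in>?W. F z = 0" if "w \<in> ?W" "G w \<noteq> 0" for w
      using holomorphic_zero_divisor[of F ?W G w] W(1,2) FG(1,3) that by (simp add: real_hol_def)
    then show "a = \<zero>\<^bsub>slice_alg D\<^esub> \<or> b = \<zero>\<^bsub>slice_alg D\<^esub>"
      unfolding FG slice_fun_ops slice_fun_eq_iff[OF D FG(1) real_hol_const]
        slice_fun_eq_iff[OF D FG(3) real_hol_const] by auto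
  qed
qed

section \<open>Fractions over an integral domain\<close>

context "domain"
begin

lemma frac_mem_iff:
  "(c, d) \<in> frac_of R a b \<longleftrightarrow> c \<in> carrier R \<and> d \<in> carrier R \<and> d \<noteq> \<zero> \<and> c \<otimes> b = a \<otimes> d"
  by (auto simp: frac_of_def)

lemma frac_self_mem: "a \<in> carrier R \<Longrightarrow> b \<in> carrier R \<Longrightarrow> b \<noteq> \<zero> \<Longrightarrow> (a, b) \<in> frac_of R a b"
  by (simp add: frac_mem_iff)

lemma frac_eqI:
  assumes "a \<in> carrier R" "b \<in> carrier R" "b \<noteq> \<zero>" "c \<in> carrier R" "d \<in> carrier R" "d \<noteq> \<zero>"
    and eq: "a \<otimes> d = c \<otimes> b"
  shows "frac_of R a b = frac_of R c d"
proof -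
  have *: "frac_of R a b \<subseteq> frac_of R c d"
    if mem: "a \<in> carrier R" "b \<in> carrier R" "c \<in> carrier R" "d \<in> carrier R"
      and b: "b \<noteq> \<zero>" and eq: "a \<otimes> d = c \<otimes> b" for a b c d
  proof clarify
    fix x y assume "(x, y) \<in> frac_of R a b"
    then have xy: "x \<in> carrier R" "y \<in> carrier R" "y \<noteq> \<zero>" "x \<otimes> b = a \<otimes> y" by (auto simp: frac_mem_iff)
    have "b \<otimes> (x \<otimes> d) = (x \<otimes> b) \<otimes> d" using mem xy(1-3) by (simp add: m_ac)
    also have "\<dots> = (a \<otimes> d) \<otimes> y" unfolding xy(4) using mem xy(1-3) by (simp add: m_ac)
    also have "\<dots> = b \<otimes> (c \<otimes> y)" unfolding eq using mem xy(1-3) by (simp add: m_ac)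
    finally have "x \<otimes> d = c \<otimes> y" using mem xy b m_lcancel by simp
    then show "(x, y) \<in> frac_of R c d" using xy by (simp add: frac_mem_iff)
  qed
  show ?thesis
    using *[of a b c d] *[of c d a b] assms by auto
qed

lemma frac_eq_iff:
  assumes "a \<in> carrier R" "b \<in> carrier R" "b \<noteq> \<zero>" "c \<in> carrier R" "d \<in> carrier R" "d \<noteq> \<zero>"
  shows "frac_of R a b = frac_of R c d \<longleftrightarrow> a \<otimes> d = c \<otimes> b"
proof
  assume "frac_of R a b = frac_of R c d"
  then have "(a, b) \<in> frac_of R c d" using frac_self_mem[of a b] assms by simp
  then show "a \<otimes> d = c \<otimes> b" by (simp add: frac_mem_iff)
qed (rule frac_eqI[OF assms])

lemma frac_memD:
  assumes "(c, d) \<in> frac_of R a b" "a \<in> carrier R" "b \<in> carrier R" "b \<noteq> \<zero>"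
  shows "frac_of R c d = frac_of R a b"
  using assms by (intro frac_eqI) (auto simp: frac_mem_iff)

lemma nonzero_mult: "b \<in> carrier R \<Longrightarrow> d \<in> carrier R \<Longrightarrow> b \<noteq> \<zero> \<Longrightarrow> d \<noteq> \<zero> \<Longrightarrow> b \<otimes> d \<noteq> \<zero>"
  using integral by blast

text \<open>The operations of the quotient field are unions over all representatives, so evaluating them amounts
  to showing that the result does not depend on the representatives.\<close>
lemma UN_frac:
  assumes "a \<in> carrier R" "b \<in> carrier R" "b \<noteq> \<zero>"
    and "\<And>a' b'. (a', b') \<in> frac_of R a b \<Longrightarrow> E a' b' = X"
  shows "(\<Union>(a', b') \<in> frac_of R a b. E a' b') = X"
  using frac_self_mem[OF assms(1-3)] assms(4) by fastforce

end

lemma quot_field_mult: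
  fixes R (structure)
  assumes "domain R" and abcd: "a \<in> carrier R" "b \<in> carrier R" "b \<noteq> \<zero>" "c \<in> carrier R" "d \<in> carrier R" "d \<noteq> \<zero>"
  shows "mult (quot_field R) (frac_of R a b) (frac_of R c d) = frac_of R (a \<otimes> c) (b \<otimes> d)"
proof -
  interpret "domain" R by fact
  show ?thesis
    unfolding quot_field_def monoid.simps
  proof (intro UN_frac abcd)
    fix a' b' c' d'
    assume "(a', b') \<in> frac_of R a b" "(c', d') \<in> frac_of R c d"
    then have m: "a' \<in> carrier R" "b' \<in> carrier R" "b' \<noteq> \<zero>" "a' \<otimes> b = a \<otimes> b'"
      "c' \<in> carrier R" "d' \<in> carrier R" "d' \<noteq> \<zero>" "c' \<otimes> d = c \<otimes> d'"
      by (auto simp: frac_mem_iff)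
    have "a' \<otimes> c' \<otimes> (b \<otimes> d) = (a' \<otimes> b) \<otimes> (c' \<otimes> d)"
      using m(1-3,5-7) abcd by (simp add: m_ac)
    also have "\<dots> = a \<otimes> c \<otimes> (b' \<otimes> d')"
      unfolding m(4,8) using m(1-3,5-7) abcd by (simp add: m_ac)
    finally show "frac_of R (a' \<otimes> c') (b' \<otimes> d') = frac_of R (a \<otimes> c) (b \<otimes> d)"
      using m abcd by (intro frac_eqI nonzero_mult) auto
  qed
qed

lemma quot_field_add:
  fixes R (structure)
  assumes "domain R" and abcd: "a \<in> carrier R" "b \<in> carrier R" "b \<noteq> \<zero>" "c \<in> carrier R" "d \<in> carrier R" "d \<noteq> \<zero>"
  shows "add (quot_field R) (frac_of R a b) (frac_of R c d) = frac_of R (a \<otimes> d \<oplus> c \<otimes> b) (b \<otimes> d)"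
proof -
  interpret "domain" R by fact
  show ?thesis
    unfolding quot_field_def ring.simps
  proof (intro UN_frac abcd)
    fix a' b' c' d'
    assume "(a', b') \<in> frac_of R a b" "(c', d') \<in> frac_of R c d"
    then have m: "a' \<in> carrier R" "b' \<in> carrier R" "b' \<noteq> \<zero>" "a' \<otimes> b = a \<otimes> b'"
      "c' \<in> carrier R" "d' \<in> carrier R" "d' \<noteq> \<zero>" "c' \<otimes> d = c \<otimes> d'"
      by (auto simp: frac_mem_iff)
    have "(a' \<otimes> d' \<oplus> c' \<otimes> b') \<otimes> (b \<otimes> d) = (a' \<otimes> b) \<otimes> (d' \<otimes> d) \<oplus> (c' \<otimes> d) \<otimes> (b' \<otimes> b)"
      using m(1-3,5-7) abcd by (simp add: m_ac l_distr r_distr)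
    also have "\<dots> = (a \<otimes> d \<oplus> c \<otimes> b) \<otimes> (b' \<otimes> d')"
      unfolding m(4,8) using m(1-3,5-7) abcd by (simp add: m_ac l_distr r_distr)
    finally show "frac_of R (a' \<otimes> d' \<oplus> c' \<otimes> b') (b' \<otimes> d') = frac_of R (a \<otimes> d \<oplus> c \<otimes> b) (b \<otimes> d)"
      using m abcd by (intro frac_eqI nonzero_mult) auto
  qed
qed

lemma quot_field_smult:
  fixes R (structure)
  assumes "domain R" and ab: "a \<in> carrier R" "b \<in> carrier R" "b \<noteq> \<zero>\<^bsub>R\<^esub>"
    and smult: "\<And>x. x \<in> carrier R \<Longrightarrow> smult R r x \<in> carrier R"
    and assoc: "\<And>x y. x \<in> carrier R \<Longrightarrow> y \<in> carrier R \<Longrightarrow> smult R r x \<otimes>\<^bsub>R\<^esub> y = smult R r (x \<otimes>\<^bsub>R\<^esub> y)"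
  shows "smult (quot_field R) r (frac_of R a b) = frac_of R (smult R r a) b"
proof -
  interpret "domain" R by fact
  show ?thesis
    unfolding quot_field_def module.simps
  proof (intro UN_frac ab)
    fix a' b' assume "(a', b') \<in> frac_of R a b"
    then show "frac_of R (r \<odot>\<^bsub>R\<^esub> a') b' = frac_of R (r \<odot>\<^bsub>R\<^esub> a) b"
      using ab by (intro frac_eqI) (auto simp: frac_mem_iff smult assoc)
  qed
qed

section \<open>Homomorphisms between quotient fields\<close>

text \<open>Fractions are handled through stems from here on.\<close>
definition slice_frac :: "quat set \<Rightarrow> (complex \<Rightarrow> complex) \<Rightarrow> (complex \<Rightarrow> complex) \<Rightarrow> ((quat \<Rightarrow> quat) \<times> (quat \<Rightarrow> quat)) set" where
  "slice_frac D a b = frac_of (slice_alg D) (slice_fun D a) (slice_fun D b)"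

definition real_hol_nz :: "complex set \<Rightarrow> (complex \<Rightarrow> complex) set" where
  "real_hol_nz W = {d \<in> real_hol W. \<exists>z\<in>W. d z \<noteq> 0}"

lemma real_hol_nzD: "d \<in> real_hol_nz W \<Longrightarrow> d \<in> real_hol W"
  by (simp add: real_hol_nz_def)

locale slice_domain =
  fixes D :: "quat set"
  assumes D: "symmetric_slice_domain D"
begin

abbreviation "W \<equiv> slice_trace D"

lemma real_hol_nz_one: "(\<lambda>z. 1) \<in> real_hol_nz W"
  using slice_trace_domain(3)[OF D] by (auto simp: real_hol_nz_def real_hol_one)

lemma real_hol_nz_mult:
  assumes "a \<in> real_hol_nz W" "b \<in> real_hol_nz W"
  shows "(\<lambda>z. a z * b z) \<in> real_hol_nz W"
proof (rule ccontr)
  assume *: "\<not> ?thesis"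
  have ab: "a \<in> real_hol W" "b \<in> real_hol W" using assms by (auto intro: real_hol_nzD)
  from * have zero: "a z * b z = 0" if "z \<in> W" for z
    using that real_hol_mult[OF ab] by (auto simp: real_hol_nz_def)
  obtain w where w: "w \<in> W" "b w \<noteq> 0" using assms(2) by (auto simp: real_hol_nz_def)
  have "a z = 0" if "z \<in> W" for z
    using holomorphic_zero_divisor[of a W b w z] ab slice_trace_domain[OF D] w zero that
    by (simp add: real_hol_def)
  then show False using assms(1) by (auto simp: real_hol_nz_def)
qed

lemma slice_fun_nonzero_iff:
  assumes "b \<in> real_hol W"
  shows "slice_fun D b \<noteq> \<zero>\<^bsub>slice_alg D\<^esub> \<longleftrightarrow> b \<in> real_hol_nz W"
  unfolding slice_alg_zero slice_fun_eq_iff[OF D assms real_hol_const]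
  using assms by (simp add: real_hol_nz_def)

lemma slice_fun_denominator:
  assumes "b \<in> real_hol_nz W"
  shows "slice_fun D b \<in> carrier (slice_alg D)" "slice_fun D b \<noteq> \<zero>\<^bsub>slice_alg D\<^esub>"
  using assms slice_fun_carrier[OF D] slice_fun_nonzero_iff by (auto dest: real_hol_nzD)

lemma slice_frac_eq_iff:
  assumes "a \<in> real_hol W" "b \<in> real_hol_nz W" "c \<in> real_hol W" "d \<in> real_hol_nz W"
  shows "slice_frac D a b = slice_frac D c d \<longleftrightarrow> (\<forall>z\<in>W. a z * d z = c z * b z)"
  unfolding slice_frac_def
  using assms by (subst domain.frac_eq_iff[OF domain_slice_alg[OF D]])
    (auto simp: slice_fun_carrier[OF D] slice_fun_denominator slice_fun_mult slice_fun_eq_iff[OF D] real_hol_mult real_hol_nzD)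

lemma slice_frac_mult:
  assumes "a \<in> real_hol W" "b \<in> real_hol_nz W" "c \<in> real_hol W" "d \<in> real_hol_nz W"
  shows "slice_frac D a b \<otimes>\<^bsub>quot_field (slice_alg D)\<^esub> slice_frac D c d = slice_frac D (\<lambda>z. a z * c z) (\<lambda>z. b z * d z)"
  unfolding slice_frac_def using assms
  by (subst quot_field_mult[OF domain_slice_alg[OF D]])
    (auto simp: slice_fun_carrier[OF D] slice_fun_denominator slice_fun_mult)

lemma slice_frac_add:
  assumes "a \<in> real_hol W" "b \<in> real_hol_nz W" "c \<in> real_hol W" "d \<in> real_hol_nz W"
  shows "slice_frac D a b \<oplus>\<^bsub>quot_field (slice_alg D)\<^esub> slice_frac D c d =
    slice_frac D (\<lambda>z. a z * d z + c z * b z) (\<lambda>z. b z * d z)"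
  unfolding slice_frac_def using assms
  by (subst quot_field_add[OF domain_slice_alg[OF D]])
    (auto simp: slice_fun_carrier[OF D] slice_fun_denominator slice_fun_mult slice_fun_add)

lemma slice_frac_smult:
  assumes "a \<in> real_hol W" "b \<in> real_hol_nz W"
  shows "r \<odot>\<^bsub>quot_field (slice_alg D)\<^esub> slice_frac D a b = slice_frac D (\<lambda>z. of_real r * a z) b"
  unfolding slice_frac_def using assms
  by (subst quot_field_smult[OF domain_slice_alg[OF D]])
    (auto simp: slice_fun_carrier[OF D] slice_fun_denominator slice_fun_smult slice_fun_mult slice_alg_carrier_eq[OF D]
      real_hol_mult real_hol_const mult.assoc dest: real_hol_nzD)

lemma slice_frac_one: "\<one>\<^bsub>quot_field (slice_alg D)\<^esub> = slice_frac D (\<lambda>z. 1) (\<lambda>z. 1)"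
  by (simp add: quot_field_def slice_frac_def slice_alg_one)

lemma frac_pair_cases:
  assumes "\<alpha> \<in> carrier (slice_alg D)" "\<beta> \<in> carrier (slice_alg D) - {\<zero>\<^bsub>slice_alg D\<^esub>}"
  obtains a b where "a \<in> real_hol W" "b \<in> real_hol_nz W" "\<alpha> = slice_fun D a" "\<beta> = slice_fun D b"
proof -
  obtain a b where "a \<in> real_hol W" "b \<in> real_hol W" "\<alpha> = slice_fun D a" "\<beta> = slice_fun D b"
    using assms slice_alg_carrier_eq[OF D] by auto
  with assms that show ?thesis
    using slice_fun_nonzero_iff by auto
qed

lemma slice_frac_cases:
  assumes "X \<in> carrier (quot_field (slice_alg D))"
  obtains a b where "a \<in> real_hol W" "b \<in> real_hol_nz W" "X = slice_frac D a b"
proof -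
  obtain \<alpha> \<beta> where X: "X = frac_of (slice_alg D) \<alpha> \<beta>" "\<alpha> \<in> carrier (slice_alg D)"
      "\<beta> \<in> carrier (slice_alg D) - {\<zero>\<^bsub>slice_alg D\<^esub>}"
    using assms by (auto simp: quot_field_def)
  show ?thesis
    by (rule frac_pair_cases[OF X(2,3)]) (simp add: that X slice_frac_def)
qed

lemma slice_frac_carrier:
  assumes "a \<in> real_hol W" "b \<in> real_hol_nz W"
  shows "slice_frac D a b \<in> carrier (quot_field (slice_alg D))"
  unfolding quot_field_def slice_frac_def using slice_fun_denominator[OF assms(2)] slice_fun_carrier[OF D assms(1)] by auto

lemma slice_frac_self_mem:
  assumes "a \<in> real_hol W" "b \<in> real_hol_nz W"
  shows "(slice_fun D a, slice_fun D b) \<in> slice_frac D a b"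
  unfolding slice_frac_def
  by (rule domain.frac_self_mem[OF domain_slice_alg[OF D] slice_fun_carrier[OF D assms(1)] slice_fun_denominator[OF assms(2)]])

lemma slice_frac_mem_cases:
  assumes X: "X \<in> carrier (quot_field (slice_alg D))" and mem: "(\<alpha>, \<beta>) \<in> X"
  obtains a b where "a \<in> real_hol W" "b \<in> real_hol_nz W" "\<alpha> = slice_fun D a" "\<beta> = slice_fun D b" "X = slice_frac D a b"
proof -
  obtain a' b' where X': "X = frac_of (slice_alg D) a' b'" "a' \<in> carrier (slice_alg D)"
      "b' \<in> carrier (slice_alg D) - {\<zero>\<^bsub>slice_alg D\<^esub>}"
    using assms by (auto simp: quot_field_def)
  then have "\<alpha> \<in> carrier (slice_alg D)" "\<beta> \<in> carrier (slice_alg D) - {\<zero>\<^bsub>slice_alg D\<^esub>}"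
    "X = frac_of (slice_alg D) \<alpha> \<beta>"
    using mem domain.frac_memD[OF domain_slice_alg[OF D], of \<alpha> \<beta> a' b']
      domain.frac_mem_iff[OF domain_slice_alg[OF D], of \<alpha> \<beta> a' b'] by auto
  then show ?thesis
    using frac_pair_cases[of \<alpha> \<beta>] that by (metis slice_frac_def)
qed

end

text \<open>In this locale \<open>\<iota> F\<close> is the element \<open>F / 1\<close> of the quotient field, and every computation takes place
  between the trace \<open>W\<close> of the source and the trace \<open>V\<close> of the target.\<close>
locale slice_field_hom = dom: slice_domain D + cod: slice_domain E for D E +
  fixes \<phi> :: "((quat \<Rightarrow> quat) \<times> (quat \<Rightarrow> quat)) set \<Rightarrow> ((quat \<Rightarrow> quat) \<times> (quat \<Rightarrow> quat)) set"
  assumes hom: "\<phi> \<in> alg_hom (quot_field (slice_alg D)) (quot_field (slice_alg E))"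
begin

abbreviation "V \<equiv> cod.W"
abbreviation "W \<equiv> dom.W"
abbreviation "\<iota> F \<equiv> slice_frac D F (\<lambda>z. 1)"

lemma quot_field_hom:
  "X \<in> carrier (quot_field (slice_alg D)) \<Longrightarrow> \<phi> X \<in> carrier (quot_field (slice_alg E))"
  "X \<in> carrier (quot_field (slice_alg D)) \<Longrightarrow> Y \<in> carrier (quot_field (slice_alg D)) \<Longrightarrow>
    \<phi> (X \<otimes>\<^bsub>quot_field (slice_alg D)\<^esub> Y) = \<phi> X \<otimes>\<^bsub>quot_field (slice_alg E)\<^esub> \<phi> Y"
  "X \<in> carrier (quot_field (slice_alg D)) \<Longrightarrow> Y \<in> carrier (quot_field (slice_alg D)) \<Longrightarrow>
    \<phi> (X \<oplus>\<^bsub>quot_field (slice_alg D)\<^esub> Y) = \<phi> X \<oplus>\<^bsub>quot_field (slice_alg E)\<^esub> \<phi> Y"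
  "\<phi> \<one>\<^bsub>quot_field (slice_alg D)\<^esub> = \<one>\<^bsub>quot_field (slice_alg E)\<^esub>"
  "X \<in> carrier (quot_field (slice_alg D)) \<Longrightarrow>
    \<phi> (r \<odot>\<^bsub>quot_field (slice_alg D)\<^esub> X) = r \<odot>\<^bsub>quot_field (slice_alg E)\<^esub> \<phi> X"
  using hom by (auto simp: alg_hom_def ring_hom_def)

lemma \<iota>_carrier: "F \<in> real_hol W \<Longrightarrow> \<iota> F \<in> carrier (quot_field (slice_alg D))"
  by (rule dom.slice_frac_carrier[OF _ dom.real_hol_nz_one])

lemma image_add:
  assumes F: "F \<in> real_hol W" and G: "G \<in> real_hol W"
    and ab: "a \<in> real_hol V" "b \<in> real_hol_nz V" "\<phi> (\<iota> F) = slice_frac E a b"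
    and cd: "c \<in> real_hol V" "d \<in> real_hol_nz V" "\<phi> (\<iota> G) = slice_frac E c d"
  shows "\<phi> (\<iota> (\<lambda>z. F z + G z)) = slice_frac E (\<lambda>z. a z * d z + c z * b z) (\<lambda>z. b z * d z)"
proof -
  have "\<iota> (\<lambda>z. F z + G z) = \<iota> F \<oplus>\<^bsub>quot_field (slice_alg D)\<^esub> \<iota> G"
    by (simp add: dom.slice_frac_add F G dom.real_hol_nz_one)
  then show ?thesis
    using quot_field_hom(3)[OF \<iota>_carrier[OF F] \<iota>_carrier[OF G]] by (simp add: ab cd cod.slice_frac_add)
qed

lemma image_mult:
  assumes F: "F \<in> real_hol W" and G: "G \<in> real_hol W"
    and ab: "a \<in> real_hol V" "b \<in> real_hol_nz V" "\<phi> (\<iota> F) = slice_frac E a b"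
    and cd: "c \<in> real_hol V" "d \<in> real_hol_nz V" "\<phi> (\<iota> G) = slice_frac E c d"
  shows "\<phi> (\<iota> (\<lambda>z. F z * G z)) = slice_frac E (\<lambda>z. a z * c z) (\<lambda>z. b z * d z)"
proof -
  have "\<iota> (\<lambda>z. F z * G z) = \<iota> F \<otimes>\<^bsub>quot_field (slice_alg D)\<^esub> \<iota> G"
    by (simp add: dom.slice_frac_mult F G dom.real_hol_nz_one)
  then show ?thesis
    using quot_field_hom(2)[OF \<iota>_carrier[OF F] \<iota>_carrier[OF G]] by (simp add: ab cd cod.slice_frac_mult)
qed

lemma image_const: "\<phi> (\<iota> (\<lambda>z. of_real r)) = slice_frac E (\<lambda>z. of_real r) (\<lambda>z. 1)"
proof -
  have "\<iota> (\<lambda>z. of_real r) = r \<odot>\<^bsub>quot_field (slice_alg D)\<^esub> \<one>\<^bsub>quot_field (slice_alg D)\<^esub>"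
    by (simp add: dom.slice_frac_one dom.slice_frac_smult dom.real_hol_nz_one real_hol_one)
  then show ?thesis
    using quot_field_hom(5)[OF \<iota>_carrier[OF real_hol_one], of r] quot_field_hom(4)
    by (simp add: dom.slice_frac_one cod.slice_frac_one cod.slice_frac_smult cod.real_hol_nz_one real_hol_one)
qed

text \<open>Injectivity of a unital homomorphism on a field: the image of \<open>F\<close> is inverted by the image of
  \<open>1 / F\<close>.\<close>
lemma image_nonzero:
  assumes F: "F \<in> real_hol_nz W" and ab: "a \<in> real_hol V" "b \<in> real_hol_nz V" "\<phi> (\<iota> F) = slice_frac E a b"
  shows "a \<in> real_hol_nz V"
proof (rule ccontr)
  assume "a \<notin> real_hol_nz V"
  then have zero: "\<forall>z\<in>V. a z = 0" using ab by (simp add: real_hol_nz_def)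
  let ?G = "slice_frac D (\<lambda>z. 1) F"
  have G: "?G \<in> carrier (quot_field (slice_alg D))"
    by (rule dom.slice_frac_carrier[OF real_hol_one F])
  obtain c d where cd: "c \<in> real_hol V" "d \<in> real_hol_nz V" "\<phi> ?G = slice_frac E c d"
    using cod.slice_frac_cases[OF quot_field_hom(1)[OF G]] by blast
  have "\<iota> F \<otimes>\<^bsub>quot_field (slice_alg D)\<^esub> ?G = \<one>\<^bsub>quot_field (slice_alg D)\<^esub>"
    using F real_hol_nzD[OF F]
    by (simp add: dom.slice_frac_mult dom.slice_frac_one dom.real_hol_nz_one real_hol_one dom.slice_frac_eq_iff)
  then have "slice_frac E (\<lambda>z. a z * c z) (\<lambda>z. b z * d z) = slice_frac E (\<lambda>z. 1) (\<lambda>z. 1)"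
    using quot_field_hom(2)[OF \<iota>_carrier[OF real_hol_nzD[OF F]] G] quot_field_hom(4) ab cd
    by (simp add: cod.slice_frac_mult cod.slice_frac_one)
  then have "\<forall>z\<in>V. a z * c z = b z * d z"
    using ab cd by (simp add: cod.slice_frac_eq_iff real_hol_mult cod.real_hol_nz_mult real_hol_one cod.real_hol_nz_one)
  then show False
    using zero cod.real_hol_nz_mult[OF ab(2) cd(2)] by (auto simp: real_hol_nz_def)
qed

text \<open>Some numerator and denominator of the image of \<open>F\<close>; their quotient \<open>germ F\<close> is well defined near each
  point, which is all that \<open>no_pole_of_germ_hom\<close> refers to.\<close>
definition rep :: "(complex \<Rightarrow> complex) \<Rightarrow> (complex \<Rightarrow> complex) \<times> (complex \<Rightarrow> complex)" where
  "rep F = (SOME ab. fst ab \<in> real_hol V \<and> snd ab \<in> real_hol_nz V \<and> \<phi> (\<iota> F) = slice_frac E (fst ab) (snd ab))"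

lemma rep:
  assumes "F \<in> real_hol W"
  shows "fst (rep F) \<in> real_hol V" "snd (rep F) \<in> real_hol_nz V" "\<phi> (\<iota> F) = slice_frac E (fst (rep F)) (snd (rep F))"
proof -
  have "\<exists>ab. fst ab \<in> real_hol V \<and> snd ab \<in> real_hol_nz V \<and> \<phi> (\<iota> F) = slice_frac E (fst ab) (snd ab)"
    using cod.slice_frac_cases[OF quot_field_hom(1)[OF \<iota>_carrier[OF assms]]] by (metis fst_conv snd_conv)
  from someI_ex[OF this, folded rep_def]
  show "fst (rep F) \<in> real_hol V" "snd (rep F) \<in> real_hol_nz V" "\<phi> (\<iota> F) = slice_frac E (fst (rep F)) (snd (rep F))"
    by blast+
qed

definition germ :: "(complex \<Rightarrow> complex) \<Rightarrow> complex \<Rightarrow> complex" where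
  "germ F = (\<lambda>z. fst (rep F) z / snd (rep F) z)"

lemma nz_eventually:
  assumes "d \<in> real_hol_nz V" "p \<in> V"
  shows "\<forall>\<^sub>F z in at p. d z \<noteq> 0"
  using assms eventually_nonzero_at[of d V _ p] slice_trace_domain[OF cod.D]
  by (auto simp: real_hol_nz_def real_hol_def)

lemma germ_eventually:
  assumes F: "F \<in> real_hol W" and ab: "a \<in> real_hol V" "b \<in> real_hol_nz V" "\<phi> (\<iota> F) = slice_frac E a b" and p: "p \<in> V"
  shows "\<forall>\<^sub>F z in at p. germ F z = a z / b z"
proof -
  have eq: "\<forall>z\<in>V. fst (rep F) z * b z = a z * snd (rep F) z"
    using rep[OF F] ab by (simp flip: cod.slice_frac_eq_iff)
  have "\<forall>\<^sub>F z in at p. z \<in> V"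
    using p slice_trace_domain(1)[OF cod.D] by (rule eventually_at_in_open'[rotated])
  then show ?thesis
    using nz_eventually[OF ab(2) p] nz_eventually[OF rep(2)[OF F] p]
    by eventually_elim (use eq in \<open>simp add: germ_def field_simps\<close>)
qed

lemma germ_no_pole:
  assumes F: "F \<in> real_hol W" and p: "p \<in> V"
  shows "\<not> is_pole (germ F) p"
proof (rule no_pole_of_germ_hom[of W germ p])
  have an: "c analytic_on {p}" if "c \<in> real_hol V" for c
    using that p slice_trace_domain(1)[OF cod.D] by (auto simp: real_hol_def intro: holomorphic_on_imp_analytic_at)
  show "germ F meromorphic_on {p}" if F: "F \<in> real_hol W" for F
    unfolding germ_def
    using an[OF rep(1)[OF F]] an[OF real_hol_nzD[OF rep(2)[OF F]]]
    by (intro meromorphic_intros analytic_on_imp_meromorphic_on) auto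
  show "\<forall>\<^sub>F z in at p. germ (\<lambda>z. F z + G z) z = germ F z + germ G z"
    if FG: "F \<in> real_hol W" "G \<in> real_hol W" for F G
  proof -
    note r = rep[OF FG(1)] rep[OF FG(2)]
    have "\<forall>\<^sub>F z in at p. germ (\<lambda>z. F z + G z) z = (fst (rep F) z * snd (rep G) z + fst (rep G) z * snd (rep F) z)
        / (snd (rep F) z * snd (rep G) z)"
      using r r(2,5)[THEN real_hol_nzD]
      by (intro germ_eventually[OF real_hol_add[OF FG] _ _ image_add[OF FG r] p]
          real_hol_add real_hol_mult cod.real_hol_nz_mult)
    then show ?thesis
      using nz_eventually[OF r(2) p] nz_eventually[OF r(5) p]
      by eventually_elim (simp add: germ_def add_frac_eq)
  qed
  show "\<forall>\<^sub>F z in at p. germ (\<lambda>z. F z * G z) z = germ F z * germ G z"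
    if FG: "F \<in> real_hol W" "G \<in> real_hol W" for F G
  proof -
    note r = rep[OF FG(1)] rep[OF FG(2)]
    have "\<forall>\<^sub>F z in at p. germ (\<lambda>z. F z * G z) z = (fst (rep F) z * fst (rep G) z)
        / (snd (rep F) z * snd (rep G) z)"
      using r
      by (intro germ_eventually[OF real_hol_mult[OF FG] _ _ image_mult[OF FG r] p]
          real_hol_mult cod.real_hol_nz_mult)
    then show ?thesis by (simp add: germ_def)
  qed
  show "\<forall>\<^sub>F z in at p. germ (\<lambda>z. of_real r) z = of_real r" for r
    using germ_eventually[OF real_hol_const _ _ image_const p] cod.real_hol_nz_one real_hol_const by simp
  show "F w = 0" if F: "F \<in> real_hol W" and zero: "\<forall>\<^sub>F z in at p. germ F z = 0" and w: "w \<in> W" for F w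
  proof (rule ccontr)
    assume "F w \<noteq> 0"
    with F w have "F \<in> real_hol_nz W" by (auto simp: real_hol_nz_def)
    then have "fst (rep F) \<in> real_hol_nz V" using image_nonzero rep[OF F] by blast
    from nz_eventually[OF this p] nz_eventually[OF rep(2)[OF F] p] zero
    have "\<forall>\<^sub>F z in at p. False" by eventually_elim (simp add: germ_def)
    then show False by simp
  qed
  show "W \<noteq> {}" using slice_trace_domain(3)[OF dom.D] by blast
qed (rule F)

text \<open>The image of \<open>F\<close> has no pole at any point of \<open>V\<close>, so its numerator is divisible by its denominator.\<close>
lemma image_holomorphic:
  assumes F: "F \<in> real_hol W"
  shows "\<exists>g\<in>real_hol V. \<phi> (\<iota> F) = slice_frac E g (\<lambda>z. 1)"
proof -
  note r = rep[OF F]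
  obtain w where w: "w \<in> V" "snd (rep F) w \<noteq> 0" using r(2) by (auto simp: real_hol_nz_def)
  obtain g where g: "g \<in> real_hol V" "\<And>z. z \<in> V \<Longrightarrow> g z * snd (rep F) z = fst (rep F) z"
    using real_hol_quotient[OF r(1) real_hol_nzD[OF r(2)] slice_trace_domain(1,2)[OF cod.D]
        slice_trace_cnj[OF cod.D] w germ_no_pole[OF F, unfolded germ_def]] by blast
  have "slice_frac E (fst (rep F)) (snd (rep F)) = slice_frac E g (\<lambda>z. 1)"
    unfolding cod.slice_frac_eq_iff[OF r(1,2) g(1) cod.real_hol_nz_one] using g(2) by simp
  then show ?thesis
    using g(1) unfolding r(3) by blast
qed

text \<open>The restriction of \<open>\<phi>\<close> to holomorphic functions.\<close>
definition \<psi> :: "(complex \<Rightarrow> complex) \<Rightarrow> complex \<Rightarrow> complex" where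
  "\<psi> F = (SOME g. g \<in> real_hol V \<and> \<phi> (\<iota> F) = slice_frac E g (\<lambda>z. 1))"

lemma \<psi>:
  assumes "F \<in> real_hol W"
  shows "\<psi> F \<in> real_hol V" "\<phi> (\<iota> F) = slice_frac E (\<psi> F) (\<lambda>z. 1)"
  using someI_ex[OF image_holomorphic[OF assms, unfolded Bex_def], folded \<psi>_def] by blast+

lemma \<psi>_eqI:
  assumes "F \<in> real_hol W" "g \<in> real_hol V" "\<phi> (\<iota> F) = slice_frac E g (\<lambda>z. 1)" "p \<in> V"
  shows "\<psi> F p = g p"
  using \<psi>[OF assms(1)] assms(2-) by (simp add: cod.slice_frac_eq_iff cod.real_hol_nz_one)

sublocale real_hol_hom W V \<psi>
proof
  show "\<psi> F p = \<psi> G p" if "F \<in> real_hol W" "G \<in> real_hol W" "\<And>z. z \<in> W \<Longrightarrow> F z = G z" for F G p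
    using that slice_fun_eq_iff[OF dom.D, of F G] by (simp add: \<psi>_def slice_frac_def)
  show "\<psi> (\<lambda>z. F z + G z) p = \<psi> F p + \<psi> G p" if "F \<in> real_hol W" "G \<in> real_hol W" "p \<in> V" for F G p
    using image_add[OF that(1,2) \<psi>(1)[OF that(1)] cod.real_hol_nz_one \<psi>(2)[OF that(1)]
        \<psi>(1)[OF that(2)] cod.real_hol_nz_one \<psi>(2)[OF that(2)]] that \<psi>(1)
    by (intro \<psi>_eqI real_hol_add) simp_all
  show "\<psi> (\<lambda>z. F z * G z) p = \<psi> F p * \<psi> G p" if "F \<in> real_hol W" "G \<in> real_hol W" "p \<in> V" for F G p
    using image_mult[OF that(1,2) \<psi>(1)[OF that(1)] cod.real_hol_nz_one \<psi>(2)[OF that(1)]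
        \<psi>(1)[OF that(2)] cod.real_hol_nz_one \<psi>(2)[OF that(2)]] that \<psi>(1)
    by (intro \<psi>_eqI real_hol_mult) simp_all
  show "\<psi> (\<lambda>z. of_real r) p = of_real r" if "p \<in> V" for r p
    by (rule \<psi>_eqI[OF real_hol_const real_hol_const image_const that])
qed (use slice_trace_domain(1)[OF dom.D] slice_trace_cnj[OF dom.D] in auto)

definition inducing_stem :: "complex \<Rightarrow> complex" where "inducing_stem = \<psi> (\<lambda>z. z)"

lemma inducing_stem: "inducing_stem \<in> real_hol V" "z \<in> V \<Longrightarrow> inducing_stem z \<in> W" "F \<in> real_hol W \<Longrightarrow> z \<in> V \<Longrightarrow> \<psi> F z = F (inducing_stem z)"
  unfolding inducing_stem_def by (rule \<psi>(1)[OF real_hol_id], erule hom_id_in_range, erule (1) hom_eq_composition)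

definition inducing_map :: "quat \<Rightarrow> quat" where "inducing_map = slice_fun E inducing_stem"

lemma inducing_map_emb:
  assumes "I \<in> imag_units" "z \<in> V"
  shows "inducing_map (slice_emb I z) = slice_emb I (inducing_stem z)"
  unfolding inducing_map_def using slice_fun_emb[OF cod.D inducing_stem(1) assms] .

lemma inducing_map_range: "inducing_map \<in> E \<rightarrow>\<^sub>E D"
proof (rule PiE_I)
  fix q assume q: "q \<in> E"
  have "inducing_stem (polar_coord q) \<in> W" using inducing_stem(2) polar_coord_mem[OF cod.D q] .
  then show "inducing_map q \<in> D"
    using inducing_map_emb[OF polar_unit polar_coord_mem[OF cod.D q], of q] slice_emb_mem_iff[OF dom.D polar_unit]
    by (simp add: slice_emb_polar)
next
  fix q assume "q \<notin> E"
  then show "inducing_map q = undefined" unfolding inducing_map_def slice_fun_def by (simp only: restrict_apply if_False)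
qed

text \<open>Let \<open>X = a / b\<close> be mapped to \<open>c / d\<close>. Applying \<open>\<phi>\<close> to \<open>X * b = a\<close> gives \<open>c * \<psi> b = \<psi> a * d\<close>, and \<open>\<psi>\<close> is
  composition with the inducing map. All values at one point lie in one slice, where quaternions
  multiply like complex numbers.\<close>
lemma inducing_map_comp_eq:
  assumes X: "X \<in> carrier (quot_field (slice_alg D))"
  shows "comp_eq E inducing_map X (\<phi> X)"
  unfolding comp_eq_def
proof (safe)
  fix \<alpha> \<beta> assume "(\<alpha>, \<beta>) \<in> X"
  then obtain a b where ab: "a \<in> real_hol W" "b \<in> real_hol_nz W" "\<alpha> = slice_fun D a" "\<beta> = slice_fun D b" "X = slice_frac D a b"
    using dom.slice_frac_mem_cases[OF X] by blast
  note b = real_hol_nzD[OF ab(2)]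
  have comp: "slice_fun D F (inducing_map (slice_emb I z)) = slice_emb I (\<psi> F z)"
    if "F \<in> real_hol W" "I \<in> imag_units" "z \<in> V" for F I z
    using that inducing_map_emb inducing_stem slice_fun_emb[OF dom.D that(1,2)] by simp
  have "\<psi> b \<in> real_hol_nz V" using image_nonzero[OF ab(2) \<psi>(1)[OF b] cod.real_hol_nz_one \<psi>(2)[OF b]] .
  then obtain w where w: "w \<in> V" "\<psi> b w \<noteq> 0" by (auto simp: real_hol_nz_def)
  show "\<exists>q\<in>E. \<beta> (inducing_map q) \<noteq> 0"
    using w comp[OF b std_unit w(1)] slice_emb_mem_iff[OF cod.D std_unit] slice_emb_inject[OF std_unit, of "\<psi> b w" 0]
    by (intro bexI[of _ "slice_emb std_unit w"]) (auto simp: ab)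
  fix \<gamma> \<delta> q assume "(\<gamma>, \<delta>) \<in> \<phi> X" and q: "q \<in> E" and nz: "\<delta> q \<noteq> 0" "\<beta> (inducing_map q) \<noteq> 0"
  then obtain c d where cd: "c \<in> real_hol V" "d \<in> real_hol_nz V" "\<gamma> = slice_fun E c" "\<delta> = slice_fun E d" "\<phi> X = slice_frac E c d"
    using cod.slice_frac_mem_cases[OF quot_field_hom(1)[OF X]] by blast
  define I where "I = polar_unit q"
  define z where "z = polar_coord q"
  have I: "I \<in> imag_units" and z: "z \<in> V" and qz: "q = slice_emb I z"
    using polar_unit polar_coord_mem[OF cod.D q] slice_emb_polar by (simp_all add: I_def z_def)
  have "X \<otimes>\<^bsub>quot_field (slice_alg D)\<^esub> \<iota> b = \<iota> a"
    unfolding ab(5) using ab b by (simp add: dom.slice_frac_mult dom.real_hol_nz_one dom.slice_frac_eq_iff real_hol_mult)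
  then have "slice_frac E (\<lambda>z. c z * \<psi> b z) (\<lambda>z. d z * 1) = slice_frac E (\<psi> a) (\<lambda>z. 1)"
    using quot_field_hom(2)[OF X \<iota>_carrier[OF b]] cd \<psi>[OF b] \<psi>[OF ab(1)]
    by (simp add: cod.slice_frac_mult cod.real_hol_nz_one)
  then have eq: "c z * \<psi> b z = \<psi> a z * d z"
    using z cd \<psi>[OF b] \<psi>[OF ab(1)] by (simp add: cod.slice_frac_eq_iff cod.real_hol_nz_one real_hol_mult)
  have vals: "\<gamma> q = slice_emb I (c z)" "\<delta> q = slice_emb I (d z)"
    "\<alpha> (inducing_map q) = slice_emb I (\<psi> a z)" "\<beta> (inducing_map q) = slice_emb I (\<psi> b z)"
    using slice_fun_emb[OF cod.D _ I z] cd real_hol_nzD[OF cd(2)] comp[OF _ I z] ab b by (simp_all add: qz)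
  have "d z \<noteq> 0" "\<psi> b z \<noteq> 0" using nz by (auto simp: vals)
  then have "c z / d z = \<psi> a z / \<psi> b z" using eq by (simp add: field_simps)
  then show "\<gamma> q / \<delta> q = \<alpha> (inducing_map q) / \<beta> (inducing_map q)"
    by (simp add: vals flip: slice_emb_divide[OF I])
qed

text \<open>The identity function is \<open>z / 1\<close> and its image is \<open>inducing_stem / 1\<close>; as both denominators are 1,
  \<open>comp_eq\<close> determines every value of \<open>k\<close>.\<close>
lemma inducing_map_unique:
  assumes maps: "k \<in> E \<rightarrow>\<^sub>E D" and comp: "comp_eq E k (\<iota> (\<lambda>z. z)) (\<phi> (\<iota> (\<lambda>z. z)))"
  shows "k = inducing_map"
proof (rule extensionalityI)
  fix q assume q: "q \<in> E"
  with maps have kq: "k q \<in> D" by (rule PiE_mem)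
  have id: "(slice_fun D (\<lambda>z. z), slice_fun D (\<lambda>z. 1)) \<in> \<iota> (\<lambda>z. z)"
    by (rule dom.slice_frac_self_mem[OF real_hol_id dom.real_hol_nz_one])
  have im: "(slice_fun E inducing_stem, slice_fun E (\<lambda>z. 1)) \<in> \<phi> (\<iota> (\<lambda>z. z))"
    unfolding \<psi>(2)[OF real_hol_id] inducing_stem_def[symmetric] by (rule cod.slice_frac_self_mem[OF inducing_stem(1) cod.real_hol_nz_one])
  have vals: "slice_fun E (\<lambda>z. 1) q = 1" "slice_fun D (\<lambda>z. 1) (k q) = 1" "slice_fun D (\<lambda>z. z) (k q) = k q"
    using q kq by (simp_all add: slice_fun_def slice_emb_polar)
  note all = conjunct2[OF bspec[OF comp[unfolded comp_eq_def] id, unfolded prod.case]]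
  have "slice_fun E inducing_stem q / 1 = k q / 1"
    using bspec[OF bspec[OF all im, unfolded prod.case] q] unfolding vals by simp
  then show "k q = inducing_map q" by (simp add: inducing_map_def)
next
  show "k \<in> extensional E" using maps by (simp add: PiE_def)
  show "inducing_map \<in> extensional E" using inducing_map_range by (simp add: PiE_def)
qed

end

theorem theorem6p7:
  fixes D Dhat :: "quat set"
    and \<phi> :: "((quat \<Rightarrow> quat) \<times> (quat \<Rightarrow> quat)) set \<Rightarrow> ((quat \<Rightarrow> quat) \<times> (quat \<Rightarrow> quat)) set"
  assumes "symmetric_slice_domain D"
    and "symmetric_slice_domain Dhat"
    and "\<phi> \<in> alg_hom (quot_field (slice_alg D)) (quot_field (slice_alg Dhat))"
  shows "\<exists>!h. h \<in> Dhat \<rightarrow>\<^sub>E D \<and> regular_on Dhat h \<and>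
           (\<forall>f\<in>carrier (quot_field (slice_alg D)). comp_eq Dhat h f (\<phi> f))"
proof -
  interpret slice_field_hom D Dhat \<phi>
    using assms by unfold_locales
  show ?thesis
  proof (rule ex1I[of _ inducing_map], intro conjI ballI)
    show "inducing_map \<in> Dhat \<rightarrow>\<^sub>E D" by (rule inducing_map_range)
    show "regular_on Dhat inducing_map"
      unfolding inducing_map_def by (rule regular_on_slice_fun[OF assms(2) inducing_stem(1)])
    show "comp_eq Dhat inducing_map f (\<phi> f)" if "f \<in> carrier (quot_field (slice_alg D))" for f
      using that by (rule inducing_map_comp_eq)
  next
    fix k assume k: "k \<in> Dhat \<rightarrow>\<^sub>E D \<and> regular_on Dhat k \<and>
      (\<forall>f\<in>carrier (quot_field (slice_alg D)). comp_eq Dhat k f (\<phi> f))"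
    show "k = inducing_map"
      using k \<iota>_carrier[OF real_hol_id] by (intro inducing_map_unique) simp_all
  qed
qed

end
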